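(* Let $X$ be a Polish space, $(\mu_n)$ a sequence in $\mathcal P(X)$ and $(a_n)$ a sequence of strictly positive reals with $\lim_na_n=+\infty$. Define $H_n^{\mathbf a}\colon\mathcal P(X)\to[0,+\infty]$ by $H_n^{\mathbf a}(\nu)=\frac1{a_n}H(\nu|\mu_n)$. There exist functionals $\overline I^{\mathbf a},\underline I^{\mathbf a}\colon X\to[0,+\infty]$ such that $\overline I^{\mathbf a}$ is the minimal lower semicontinuous functional for which the large deviations lower bound for $(\mu_n)$ with speed $(a_n)$ holds, and $\underline I^{\mathbf a}$ is the maximal lower semicontinuous functional for which the large deviations weak upper bound for $(\mu_n)$ with speed $(a_n)$ holds. A weak large deviations principle holds for $(\mu_n)$ with speed $(a_n)$ iff $\overline I^{\mathbf a}=\underline I^{\mathbf a}$. The following representations hold for all $x\in X$: $$\overline I^{\mathbf a}(x)=\big(\Gamma\text{-}\varlimsup_nH_n^{\mathbf a}\big)(\delta_x)=\lim_{\delta\downarrow0}\varlimsup_n\tfrac{-1}{a_n}\log\mu_n(B_\delta(x))=\sup_{(V_n)}\big(\Gamma\text{-}\varlimsup_nV_n\big)(x),$$ $$\underline I^{\mathbf a}(x)=\big(\Gamma\text{-}\varliminf_nH_n^{\mathbf a}\big)(\delta_x)=\lim_{\delta\downarrow0}\varliminf_n\tfrac{-1}{a_n}\log\mu_n(B_\delta(x))=\sup_{(V_n)}\big(\Gamma\text{-}\varliminf_nV_n\big)(x),$$ where the suprema are over all sequences $(V_n)$ such that $V_n\colon X\to[-\infty,+\infty]$ is measurable (or equivalently,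 continuous and bounded) and $\mu_n(e^{a_nV_n})\le1$ (or equivalently, $\mu_n(e^{a_nV_n})=1$, or equivalently, $\varlimsup_na_n^{-1}\log\mu_n(e^{a_nV_n})\le0$).
   Context: $\mathcal P(X)$ is the space of Borel probability measures on $X$ with the narrow (weak) topology; $\mu(f)$ denotes the integral of $f$ with respect to $\mu$; $\delta_x$ is the Dirac mass at $x$; $B_\delta(x)$ is the open ball of radius $\delta$ centered at $x$ for a fixed compatible distance on $X$. The relative entropy is $H(\nu|\mu)=\sup_\varphi\{\nu(\varphi)-\log\mu(e^\varphi)\}$, the supremum being over bounded Borel functions $\varphi$ on $X$. Convention: $-\log0=+\infty$. $(\mu_n)$ satisfies, with speed $(a_n)$ and rate $I\colon X\to[0,+\infty]$: a large deviations lower bound iff $\varliminf_n\frac1{a_n}\log\mu_n(O)\ge-\inf_{x\in O}I(x)$ for each open $O\subset X$; a large deviations weak upper bound iff $\varlimsup_n\frac1{a_n}\log\mu_n(K)\le-\inf_{x\in K}I(x)$ for each compact $K\subset X$; a weak large deviations principle iff both bounds hold with the same lower semicontinuous rate and same speed. For a sequence of functions $F_n\colon Z\to[-\infty,+\infty]$ on a Polish space $Z$ and $z\in Z$: $\big(\Gamma\text{-}\varliminf_nF_n\big)(z)=\inf\{\varliminf_nF_n(z_n)\}$ and $\big(\Gamma\text{-}\varlimsup_nF_n\big)(z)=\inf\{\varlimsup_nF_n(z_n)\}$, both infima being over all sequences $(z_n)$ in $Z$ with $z_n\to z$. "Or equivalently" in the claim means that the suprema do not change when the class of sequences $(V_n)$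 is replaced by the alternative one. *)

theory Defs
  imports "HOL-Probability.Probability"
begin

subsection \<open>Extended exponential and logarithm\<close>

definition eexp :: "ereal \<Rightarrow> ennreal" where
  "eexp v = (if v = \<infinity> then \<infinity> else if v = -\<infinity> then 0 else ennreal (exp (real_of_ereal v)))"

definition eln :: "ennreal \<Rightarrow> ereal" where
  "eln t = (if t = 0 then -\<infinity> else if t = \<infinity> then \<infinity> else ereal (ln (enn2real t)))"


subsection \<open>Probability measures, narrow topology, relative entropy\<close>

abbreviation borel_probs :: "'a::topological_space measure set" where
  "borel_probs \<equiv> space (prob_algebra borel)"

text \<open>The coarsest topology on the Borel probability measures that makes
  \<open>\<nu> \<mapsto> \<integral>f d\<nu>\<close> continuous for every bounded continuous real function \<open>f\<close>.\<close>

definition narrow_topology :: "'a::topological_space measure topology" where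
  "narrow_topology = topology_generated_by
     {{\<nu> \<in> borel_probs. (\<integral>x. f x \<partial>\<nu>) \<in> U} | (f :: 'a \<Rightarrow> real) U.
        continuous_on UNIV f \<and> bounded (range f) \<and> open U}"

lemma topspace_narrow_topology [simp]: "topspace narrow_topology = borel_probs"
proof -
  have "{\<nu> \<in> borel_probs. (\<integral>x. (0::real) \<partial>\<nu>) \<in> UNIV} \<in>
     {{\<nu> \<in> borel_probs. (\<integral>x. f x \<partial>\<nu>) \<in> U} | (f :: 'a::topological_space \<Rightarrow> real) U.
        continuous_on UNIV f \<and> bounded (range f) \<and> open U}"
    by (rule CollectI, rule exI[of _ "\<lambda>_. 0"], rule exI[of _ UNIV]) auto
  then show ?thesis
    unfolding narrow_topology_def topology_generated_by_topspace by auto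
qed

lemma limitin_narrow_topology:
  fixes \<nu> :: "'a::topological_space measure"
  assumes "\<And>n. \<nu>s n \<in> borel_probs" "\<nu> \<in> borel_probs"
  shows "limitin narrow_topology \<nu>s \<nu> F \<longleftrightarrow>
    (\<forall>f :: 'a \<Rightarrow> real. continuous_on UNIV f \<and> bounded (range f) \<longrightarrow>
        ((\<lambda>n. \<integral>x. f x \<partial>\<nu>s n) \<longlongrightarrow> (\<integral>x. f x \<partial>\<nu>)) F)"
    (is "?L \<longleftrightarrow> ?R")
proof
  assume L: ?L
  show ?R
  proof (intro allI impI topological_tendstoI)
    fix f :: "'a \<Rightarrow> real" and U :: "real set"
    assume f: "continuous_on UNIV f \<and> bounded (range f)"
      and U: "open U" "(\<integral>x. f x \<partial>\<nu>) \<in> U"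
    have "openin narrow_topology {\<nu> \<in> borel_probs. (\<integral>x. f x \<partial>\<nu>) \<in> U}"
      unfolding narrow_topology_def
      by (rule topology_generated_by_Basis, rule CollectI, rule exI[of _ f], rule exI[of _ U])
        (use f U in simp)
    moreover have "\<nu> \<in> {\<nu> \<in> borel_probs. (\<integral>x. f x \<partial>\<nu>) \<in> U}"
      using U(2) assms(2) by simp
    ultimately have "\<forall>\<^sub>F n in F. \<nu>s n \<in> {\<nu> \<in> borel_probs. (\<integral>x. f x \<partial>\<nu>) \<in> U}"
      using L unfolding limitin_def by metis
    then show "\<forall>\<^sub>F n in F. (\<integral>x. f x \<partial>\<nu>s n) \<in> U"
      by (rule eventually_mono) simp
  qed
next
  assume R: ?R
  have "\<nu> \<in> W \<longrightarrow> (\<forall>\<^sub>F n in F. \<nu>s n \<in> W)"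
    if "generate_topology_on {{\<nu> \<in> borel_probs. (\<integral>x. f x \<partial>\<nu>) \<in> U} | (f :: 'a \<Rightarrow> real) U.
        continuous_on UNIV f \<and> bounded (range f) \<and> open U} W" for W
    using that
  proof induction
    case (Int a b)
    then show ?case by (auto intro: eventually_conj)
  next
    case (UN K)
    show ?case
    proof
      assume "\<nu> \<in> \<Union>K"
      then obtain k where k: "k \<in> K" "\<nu> \<in> k" by blast
      with UN have "\<forall>\<^sub>F n in F. \<nu>s n \<in> k" by blast
      then show "\<forall>\<^sub>F n in F. \<nu>s n \<in> \<Union>K"
        by (rule eventually_mono) (use k in blast)
    qed
  next
    case (Basis s)
    then obtain f :: "'a \<Rightarrow> real" and U where
      s: "s = {\<nu> \<in> borel_probs. (\<integral>x. f x \<partial>\<nu>) \<in> U}"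
      and f: "continuous_on UNIV f \<and> bounded (range f)" "open U" by auto
    from R f(1) have T: "((\<lambda>n. \<integral>x. f x \<partial>\<nu>s n) \<longlongrightarrow> (\<integral>x. f x \<partial>\<nu>)) F" by simp
    show ?case
    proof
      assume "\<nu> \<in> s"
      then have "\<forall>\<^sub>F n in F. (\<integral>x. f x \<partial>\<nu>s n) \<in> U"
        using topological_tendstoD[OF T f(2)] s by simp
      then show "\<forall>\<^sub>F n in F. \<nu>s n \<in> s"
        by (rule eventually_mono) (simp add: s assms(1))
    qed
  qed simp
  then have "\<And>W. openin narrow_topology W \<Longrightarrow> \<nu> \<in> W \<Longrightarrow> \<forall>\<^sub>F n in F. \<nu>s n \<in> W"
    unfolding narrow_topology_def openin_topology_generated_by_iff by simp
  then show ?L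
    using assms(2) unfolding limitin_def topspace_narrow_topology by blast
qed

text \<open>Meant for probability measures \<open>\<nu>\<close>, \<open>\<mu>\<close>: both integrals are then finite, and the second
  one is strictly positive.\<close>

definition rel_entropy :: "'a::topological_space measure \<Rightarrow> 'a measure \<Rightarrow> ereal" where
  "rel_entropy \<nu> \<mu> = (SUP \<phi> \<in> {\<phi> :: 'a \<Rightarrow> real. \<phi> \<in> borel_measurable borel \<and> bounded (range \<phi>)}.
     ereal ((\<integral>x. \<phi> x \<partial>\<nu>) - ln (\<integral>x. exp (\<phi> x) \<partial>\<mu>)))"

definition scaled_entropy ::
    "(nat \<Rightarrow> 'a::topological_space measure) \<Rightarrow> (nat \<Rightarrow> real) \<Rightarrow> nat \<Rightarrow> 'a measure \<Rightarrow> ereal" where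
  "scaled_entropy \<mu> a n \<nu> = ereal (1 / a n) * rel_entropy \<nu> (\<mu> n)"


subsection \<open>Sequential Gamma-limits\<close>

definition Gamma_liminf :: "'b topology \<Rightarrow> (nat \<Rightarrow> 'b \<Rightarrow> ereal) \<Rightarrow> 'b \<Rightarrow> ereal" where
  "Gamma_liminf Z F z =
     (INF zs \<in> {zs. (\<forall>n. zs n \<in> topspace Z) \<and> limitin Z zs z sequentially}.
        liminf (\<lambda>n. F n (zs n)))"

definition Gamma_limsup :: "'b topology \<Rightarrow> (nat \<Rightarrow> 'b \<Rightarrow> ereal) \<Rightarrow> 'b \<Rightarrow> ereal" where
  "Gamma_limsup Z F z =
     (INF zs \<in> {zs. (\<forall>n. zs n \<in> topspace Z) \<and> limitin Z zs z sequentially}.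
        limsup (\<lambda>n. F n (zs n)))"


subsection \<open>Large deviations\<close>

definition lsc :: "('a::topological_space \<Rightarrow> ereal) \<Rightarrow> bool" where
  "lsc I \<longleftrightarrow> (\<forall>c. closed {x. I x \<le> c})"

definition lsc_rate :: "('a::topological_space \<Rightarrow> ereal) \<Rightarrow> bool" where
  "lsc_rate I \<longleftrightarrow> (\<forall>x. 0 \<le> I x) \<and> lsc I"

definition LD_lower_bound ::
    "(nat \<Rightarrow> 'a::topological_space measure) \<Rightarrow> (nat \<Rightarrow> real) \<Rightarrow> ('a \<Rightarrow> ereal) \<Rightarrow> bool" where
  "LD_lower_bound \<mu> a I \<longleftrightarrow>
     (\<forall>U. open U \<longrightarrow>
        liminf (\<lambda>n. ereal (1 / a n) * eln (emeasure (\<mu> n) U)) \<ge> - (INF x\<in>U. I x))"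

definition LD_weak_upper_bound ::
    "(nat \<Rightarrow> 'a::topological_space measure) \<Rightarrow> (nat \<Rightarrow> real) \<Rightarrow> ('a \<Rightarrow> ereal) \<Rightarrow> bool" where
  "LD_weak_upper_bound \<mu> a I \<longleftrightarrow>
     (\<forall>K. compact K \<longrightarrow>
        limsup (\<lambda>n. ereal (1 / a n) * eln (emeasure (\<mu> n) K)) \<le> - (INF x\<in>K. I x))"

definition weak_LDP ::
    "(nat \<Rightarrow> 'a::topological_space measure) \<Rightarrow> (nat \<Rightarrow> real) \<Rightarrow> bool" where
  "weak_LDP \<mu> a \<longleftrightarrow> (\<exists>I. lsc_rate I \<and> LD_lower_bound \<mu> a I \<and> LD_weak_upper_bound \<mu> a I)"


subsection \<open>The classes of test sequences\<close>

definition measurable_seq :: "(nat \<Rightarrow> 'a::topological_space \<Rightarrow> ereal) \<Rightarrow> bool" where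
  "measurable_seq V \<longleftrightarrow> (\<forall>n. V n \<in> borel_measurable borel)"

text \<open>Each single function is bounded; no bound uniform in \<open>n\<close> is required.\<close>

definition cont_bounded_seq :: "(nat \<Rightarrow> 'a::topological_space \<Rightarrow> ereal) \<Rightarrow> bool" where
  "cont_bounded_seq V \<longleftrightarrow>
     (\<forall>n. continuous_on UNIV (V n) \<and> (\<exists>c::real. \<forall>x. \<bar>V n x\<bar> \<le> ereal c))"

definition exp_integral ::
    "(nat \<Rightarrow> 'a measure) \<Rightarrow> (nat \<Rightarrow> real) \<Rightarrow> (nat \<Rightarrow> 'a \<Rightarrow> ereal) \<Rightarrow> nat \<Rightarrow> ennreal" where
  "exp_integral \<mu> a V n = (\<integral>\<^sup>+x. eexp (ereal (a n) * V n x) \<partial>\<mu> n)"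

definition exp_integral_le_1 ::
    "(nat \<Rightarrow> 'a measure) \<Rightarrow> (nat \<Rightarrow> real) \<Rightarrow> (nat \<Rightarrow> 'a \<Rightarrow> ereal) \<Rightarrow> bool" where
  "exp_integral_le_1 \<mu> a V \<longleftrightarrow> (\<forall>n. exp_integral \<mu> a V n \<le> 1)"

definition exp_integral_eq_1 ::
    "(nat \<Rightarrow> 'a measure) \<Rightarrow> (nat \<Rightarrow> real) \<Rightarrow> (nat \<Rightarrow> 'a \<Rightarrow> ereal) \<Rightarrow> bool" where
  "exp_integral_eq_1 \<mu> a V \<longleftrightarrow> (\<forall>n. exp_integral \<mu> a V n = 1)"

definition exp_integral_limsup ::
    "(nat \<Rightarrow> 'a measure) \<Rightarrow> (nat \<Rightarrow> real) \<Rightarrow> (nat \<Rightarrow> 'a \<Rightarrow> ereal) \<Rightarrow> bool" where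
  "exp_integral_limsup \<mu> a V \<longleftrightarrow>
     limsup (\<lambda>n. ereal (1 / a n) * eln (exp_integral \<mu> a V n)) \<le> 0"

end

theory Submission
  imports Defs
begin

text \<open>
Write \<open>cost n U\<close> for minus the logarithm of the mass of \<open>U\<close> under \<open>\<mu> n\<close>, divided by \<open>a n\<close>. The
upper and the lower functional at \<open>x\<close> are the suprema, over the open neighbourhoods \<open>U\<close> of \<open>x\<close>, of the
upper and the lower limit of \<open>cost n U\<close>. Since smaller sets have larger costs, these are the limits along
balls for any compatible distance, and they are lower semicontinuous by construction.

The other representations say that near \<open>x\<close> neither entropies nor normalised exponential test functions
can see more than the cost of small neighbourhoods. In one direction, take a continuous bump \<open>f\<close>
supported in \<open>U\<close> with peak value \<open>1\<close> at \<open>x\<close>, and a constant \<open>c \<ge> 0\<close>. Normalising \<open>c * f\<close> to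
exponential integral \<open>1\<close> lowers it, up to \<open>ln 2 / a n\<close>, by at most \<open>c\<close> minus the minimum of \<open>c\<close> and
\<open>cost n U\<close> (\<open>log_mgf_bump_le\<close>). The result is both an admissible test sequence and a test function in
the variational formula for the entropy; evaluated at points converging to \<open>x\<close>, or integrated against
measures converging narrowly to the Dirac mass at \<open>x\<close>, it is asymptotically at least that minimum
(\<open>min_cost_le_lim\<close>). As \<open>c\<close> is arbitrary, the rate is a lower bound for the Gamma-limit
of the entropies and for the supremum over test sequences.

In the other direction, a diagonal argument (\<open>lim_mode_diagonal\<close>) gives balls shrinking to \<open>x\<close> whose
costs are asymptotically at most the rate. The measures conditioned on these balls converge narrowly to
the Dirac mass, and their scaled entropy is at most the cost (\<open>Gamma_entropy_le_rate\<close>). By Chebyshev's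
inequality every test sequence has in each ball a point where it exceeds the cost by at most a
vanishing amount (\<open>Gamma_test_le_rate\<close>).

The lower bound with \<open>J\<close> is equivalent to \<open>J\<close> being at least the upper rate pointwise
(\<open>LD_lower_bound_iff_rate_le\<close>). The weak upper bound holds for the lower rate by covering a compact set
with finitely many neighbourhoods. The lower rate is maximal, because a larger lower semicontinuous \<open>J\<close>
would violate the upper bound on a compact set assembled from \<open>x\<close> and compact subsets of shrinking
balls, obtained by inner regularity (\<open>le_rate_liminf\<close>). A weak large deviations principle with rate
\<open>I\<close> then squeezes \<open>I\<close> between the two functionals.
\<close>

section \<open>The two modes of limit\<close>

text \<open>The two halves of the theorem differ only in whether upper or lower limits in \<open>n\<close> are taken. What
the argument needs of the limit operation is monotonicity, insensitivity to null sequences,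
commutation with truncation and a diagonal selection, and these four hold for both operations.\<close>

definition lim_mode :: "((nat \<Rightarrow> ereal) \<Rightarrow> ereal) \<Rightarrow> bool" where
  "lim_mode L \<longleftrightarrow> L = liminf \<or> L = limsup"

definition Gamma_lim ::
    "((nat \<Rightarrow> ereal) \<Rightarrow> ereal) \<Rightarrow> 'b topology \<Rightarrow> (nat \<Rightarrow> 'b \<Rightarrow> ereal) \<Rightarrow> 'b \<Rightarrow> ereal" where
  "Gamma_lim L Z F z =
     (INF zs \<in> {zs. (\<forall>n. zs n \<in> topspace Z) \<and> limitin Z zs z sequentially}. L (\<lambda>n. F n (zs n)))"

lemma Gamma_lim_liminf: "Gamma_lim liminf = Gamma_liminf"
  by (intro ext) (simp add: Gamma_lim_def Gamma_liminf_def)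

lemma Gamma_lim_limsup: "Gamma_lim limsup = Gamma_limsup"
  by (intro ext) (simp add: Gamma_lim_def Gamma_limsup_def)

lemma lim_mode_mono:
  assumes "lim_mode L" "\<forall>\<^sub>F n in sequentially. f n \<le> g n"
  shows "L f \<le> L g"
  using assms(1) Liminf_mono[OF assms(2)] Limsup_mono[OF assms(2)] unfolding lim_mode_def by auto

lemma lim_mode_add_null:
  assumes "lim_mode L" and e: "e \<longlonglongrightarrow> 0"
  shows "L (\<lambda>n. f n + e n) = L f"
  using assms(1) ereal_liminf_lim_add[OF e, of f] ereal_limsup_lim_add[OF e, of f]
  unfolding lim_mode_def by (elim disjE) (simp_all add: add.commute)

lemma lim_mode_min:
  fixes c :: ereal
  assumes "lim_mode L"
  shows "L (\<lambda>n. min c (f n)) = min c (L f)"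
proof -
  have "continuous_on UNIV (\<lambda>t. min c t)" by (intro continuous_intros)
  moreover have "mono (\<lambda>t. min c t)" by (intro monoI min.mono order_refl)
  ultimately show ?thesis
    using assms Liminf_compose_continuous_mono[of "min c" sequentially f]
      Limsup_compose_continuous_mono[of "min c" sequentially f]
    unfolding lim_mode_def by (elim disjE) simp_all
qed

lemma lim_mode_nonneg:
  assumes "lim_mode L" "\<And>n. 0 \<le> f n"
  shows "0 \<le> L f"
  using lim_mode_mono[OF assms(1), of "\<lambda>_. 0" f] assms unfolding lim_mode_def
  by (auto simp: Liminf_const Limsup_const)

text \<open>Instead of a fixed index \<open>k\<close> one may use an index \<open>\<kappa> n\<close> that tends to infinity with \<open>n\<close> at no
extra cost. For upper limits every bound slightly above the supremum holds from some time on, so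
\<open>\<kappa>\<close> grows slowly enough to wait for it. For lower limits each bound holds infinitely often, so it
suffices to arrange that \<open>\<kappa>\<close> takes the value \<open>k\<close> at a time when the \<open>k\<close>-th bound holds.\<close>

lemma lim_mode_diagonal:
  fixes f :: "nat \<Rightarrow> nat \<Rightarrow> ereal"
  assumes L: "lim_mode L" and nonneg: "\<And>k n. 0 \<le> f k n"
  obtains \<kappa> where "filterlim \<kappa> at_top sequentially" "L (\<lambda>n. f (\<kappa> n) n) \<le> (SUP k. L (f k))"
proof (cases "(SUP k. L (f k)) = \<infinity>")
  case True
  then show ?thesis using that[of "\<lambda>n. n"] filterlim_ident by auto
next
  case False
  define S where "S = (SUP k. L (f k))"
  have upper: "L (f k) \<le> S" for k unfolding S_def by (rule SUP_upper) simp
  have "0 \<le> S" using lim_mode_nonneg[OF L nonneg] upper[of 0] by (rule order_trans)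
  with False have fin: "\<bar>S\<bar> \<noteq> \<infinity>" unfolding S_def by auto
  define c where "c k = S + ereal (1 / real (Suc k))" for k
  have c_gt: "S < c k" for k unfolding c_def using fin by (cases S) auto
  have "(\<lambda>k. S + ereal (1 / real (Suc k))) \<longlonglongrightarrow> S + ereal 0"
    by (intro tendsto_intros LIMSEQ_Suc[OF lim_1_over_n] tendsto_ereal) (use fin in auto)
  then have c_lim: "c \<longlonglongrightarrow> S" unfolding c_def by (simp add: zero_ereal_def[symmetric])
  from L consider "L = limsup" | "L = liminf" unfolding lim_mode_def by blast
  then show ?thesis
  proof cases
    case 1
    have ev: "\<exists>N. \<forall>n\<ge>N. f k n < c k" for k
      using Limsup_lessD[of sequentially "f k" "c k"] upper[of k] c_gt[of k] 1
      by (simp add: eventually_sequentially)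
    \<comment> \<open>The indices whose bound already holds for good at time \<open>n\<close>; the condition \<open>k \<le> n\<close> keeps the
      maximum finite.\<close>
    define A where "A n = {k. k \<le> n \<and> (\<forall>m\<ge>n. f k m < c k)}" for n
    have fin_A: "finite (A n)" for n by (rule finite_subset[of _ "{..n}"]) (auto simp: A_def)
    have in_A: "\<exists>N. \<forall>n\<ge>N. k \<in> A n" for k
    proof -
      obtain N where "\<forall>n\<ge>N. f k n < c k" using ev by blast
      then show ?thesis by (intro exI[of _ "max N k"]) (auto simp: A_def)
    qed
    define \<kappa> where "\<kappa> n = Max (A n)" for n
    have \<kappa>_lim: "filterlim \<kappa> at_top sequentially"
      unfolding filterlim_at_top eventually_sequentially \<kappa>_def
      using in_A Max_ge[OF fin_A] by meson
    have "\<forall>\<^sub>F n in sequentially. f (\<kappa> n) n \<le> c (\<kappa> n)"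
    proof -
      obtain N where "\<forall>n\<ge>N. 0 \<in> A n" using in_A by blast
      then have "\<kappa> n \<in> A n" if "n \<ge> N" for n
        unfolding \<kappa>_def using that by (intro Max_in fin_A) auto
      then show ?thesis
        unfolding eventually_sequentially A_def by (intro exI[of _ N]) (auto intro: less_imp_le)
    qed
    then have "limsup (\<lambda>n. f (\<kappa> n) n) \<le> limsup (\<lambda>n. c (\<kappa> n))" by (rule Limsup_mono)
    also have "\<dots> = S"
      by (intro lim_imp_Limsup filterlim_compose[OF c_lim \<kappa>_lim]) simp
    finally show ?thesis using that \<kappa>_lim 1 S_def by blast
  next
    case 2
    have freq: "\<exists>n>m. f k n < c k" for k m
    proof (rule ccontr)
      assume "\<not> ?thesis"
      then have "c k \<le> f k n" if "n > m" for n using that by (meson not_less)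
      then have "\<forall>\<^sub>F n in sequentially. c k \<le> f k n"
        by (rule eventually_mono[OF eventually_gt_at_top])
      then have "c k \<le> L (f k)" using Liminf_bounded 2 by blast
      then show False using c_gt[of k] upper[of k] by simp
    qed
    \<comment> \<open>A subsequence along which the \<open>k\<close>-th bound is met at its \<open>k\<close>-th place. Off the
      subsequence it only matters that \<open>\<kappa>\<close> tends to infinity.\<close>
    have "\<exists>s. \<forall>k. f k (s k) < c k \<and> s k < s (Suc k)"
    proof (rule dependent_nat_choice)
      show "\<exists>n. f 0 n < c 0" using freq by blast
      show "\<exists>n'. f (Suc k) n' < c (Suc k) \<and> n < n'" for n k using freq by blast
    qed
    then obtain s where s: "\<And>k. f k (s k) < c k" "strict_mono s"
      unfolding strict_mono_Suc_iff by blast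
    define \<kappa> where "\<kappa> n = (LEAST k. n \<le> s k)" for n
    have ex: "n \<le> s n" for n using s(2) by (rule seq_suble)
    have "\<kappa> (s k) = k" for k
      unfolding \<kappa>_def using s(2) by (intro Least_equality) (auto simp: strict_mono_less_eq)
    then have along: "f (\<kappa> (s k)) (s k) \<le> c k" for k using s(1)[of k] by simp
    have "k \<le> \<kappa> n" if "n \<ge> s k" for k n
    proof -
      have "n \<le> s (\<kappa> n)" unfolding \<kappa>_def by (rule LeastI[of _ n]) (rule ex)
      with that show ?thesis using s(2) strict_mono_less_eq le_trans by blast
    qed
    then have \<kappa>_lim: "filterlim \<kappa> at_top sequentially"
      unfolding filterlim_at_top eventually_sequentially by blast
    have "liminf (\<lambda>n. f (\<kappa> n) n) \<le> liminf ((\<lambda>n. f (\<kappa> n) n) \<circ> s)"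
      by (rule liminf_subseq_mono[OF s(2)])
    also have "\<dots> \<le> liminf c" by (rule Liminf_mono) (simp add: along)
    also have "\<dots> = S" by (intro lim_imp_Liminf c_lim) simp
    finally show ?thesis using that \<kappa>_lim 2 S_def by blast
  qed
qed

section \<open>Exponential cost of an event\<close>

definition decay :: "real \<Rightarrow> ennreal \<Rightarrow> ereal" where
  "decay a t = ereal (- 1 / a) * eln t"

text \<open>Passing to this multiplicative form replaces case distinctions at \<open>0\<close> and \<open>\<infinity>\<close> in the logarithm by
inequalities between masses.\<close>

lemma le_decay_iff:
  assumes a: "0 < a"
  shows "ereal c \<le> decay a t \<longleftrightarrow> t \<le> ennreal (exp (- (a * c)))"
proof (cases t)
  case (real r)
  show ?thesis
  proof (cases "r = 0")
    case False
    with real have r: "0 < r" by simp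
    then have "ereal c \<le> decay a t \<longleftrightarrow> c \<le> - ln r / a"
      using real by (simp add: decay_def eln_def)
    also have "\<dots> \<longleftrightarrow> ln r \<le> - (a * c)" using a by (auto simp: field_simps)
    also have "\<dots> \<longleftrightarrow> r \<le> exp (- (a * c))" using exp_le_cancel_iff[of "ln r" "- (a * c)"] r by simp
    finally show ?thesis using real r by simp
  qed (use a real in \<open>simp add: decay_def eln_def\<close>)
qed (use a in \<open>simp add: decay_def eln_def top_unique\<close>)

lemma decay_antimono:
  assumes "0 < a" "s \<le> t"
  shows "decay a t \<le> decay a s"
proof -
  have "y \<le> decay a s" if "y < decay a t" for y
  proof (cases y)
    case (real r)
    then show ?thesis using that le_decay_iff[OF assms(1)] assms(2) by (metis less_imp_le order_trans)
  qed (use that in auto)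
  then show ?thesis by (rule dense_le)
qed

lemma decay_nonneg:
  assumes "0 < a" "t \<le> 1"
  shows "0 \<le> decay a t"
  using le_decay_iff[of a 0 t] assms by (simp add: zero_ereal_def)

lemma minus_decay: "ereal (1 / a) * eln t = - decay a t"
  unfolding decay_def by (cases "eln t") (auto simp: ereal_mult_minus_left)

section \<open>Narrow convergence to a Dirac mass\<close>

lemma probs_D:
  assumes "\<nu> \<in> borel_probs"
  shows "prob_space \<nu>" "sets \<nu> = sets borel" "space \<nu> = UNIV"
proof -
  show "prob_space \<nu>" and s: "sets \<nu> = sets borel" using assms by (simp_all add: space_prob_algebra)
  show "space \<nu> = UNIV" using sets_eq_imp_space_eq[OF s] by simp
qed

lemma return_in_borel_probs: "return borel x \<in> borel_probs"
  by (simp add: space_prob_algebra prob_space_return)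

lemma integrable_bounded_borel:
  fixes \<phi> :: "'a::topological_space \<Rightarrow> real"
  assumes "\<nu> \<in> borel_probs" "\<phi> \<in> borel_measurable borel" "bounded (range \<phi>)"
  shows "integrable \<nu> \<phi>"
proof -
  interpret prob_space \<nu> using probs_D[OF assms(1)] by simp
  obtain b where "\<And>x. norm (\<phi> x) \<le> b" using assms(3) unfolding bounded_iff by blast
  then show ?thesis
    using assms(2) probs_D(2)[OF assms(1)]
    by (intro integrable_const_bound[where B = b]) (auto simp: measurable_def cong: measurable_cong_sets)
qed

lemma bounded_exp:
  assumes "bounded (range (\<phi> :: 'a \<Rightarrow> real))"
  shows "bounded (range (\<lambda>x. exp (\<phi> x)))"
proof -
  obtain b where "\<And>x. norm (\<phi> x) \<le> b" using assms unfolding bounded_iff by blast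
  then have "norm (exp (\<phi> x)) \<le> exp b" for x by (simp add: abs_le_iff)
  then show ?thesis unfolding bounded_iff by blast
qed

lemma narrow_lim_return_iff:
  fixes x :: "'a::topological_space"
  assumes "\<And>n. \<nu> n \<in> borel_probs"
  shows "limitin narrow_topology \<nu> (return borel x) sequentially \<longleftrightarrow>
    (\<forall>f :: 'a \<Rightarrow> real. continuous_on UNIV f \<and> bounded (range f) \<longrightarrow> (\<lambda>n. \<integral>y. f y \<partial>\<nu> n) \<longlonglongrightarrow> f x)"
proof -
  have "(\<integral>y. f y \<partial>return borel x) = f x" if "continuous_on UNIV f" for f :: "'a \<Rightarrow> real"
    using borel_measurable_continuous_onI[OF that] by (intro integral_return) auto
  then show ?thesis
    using limitin_narrow_topology[of \<nu> "return borel x" sequentially] assms return_in_borel_probs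
    by (metis (no_types, lifting))
qed

text \<open>Only values of a test function near \<open>x\<close> contribute, where continuity makes them close to its value
at \<open>x\<close>.\<close>

lemma narrow_lim_return_shrinking:
  fixes x :: "'a::metric_space"
  assumes \<nu>: "\<And>n. \<nu> n \<in> borel_probs"
    and supp: "\<And>n. AE y in \<nu> n. y \<in> ball x (r n)" and r: "r \<longlonglongrightarrow> 0"
  shows "limitin narrow_topology \<nu> (return borel x) sequentially"
  unfolding narrow_lim_return_iff[OF \<nu>]
proof (intro allI impI)
  fix f :: "'a \<Rightarrow> real" assume f: "continuous_on UNIV f \<and> bounded (range f)"
  show "(\<lambda>n. \<integral>y. f y \<partial>\<nu> n) \<longlonglongrightarrow> f x"
  proof (rule tendstoI)
    fix e :: real assume e: "0 < e"
    have "isCont f x" using f continuous_on_eq_continuous_at[of UNIV f] by auto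
    then obtain d where d: "d > 0" "\<And>y. dist y x < d \<Longrightarrow> dist (f y) (f x) < e / 2"
      using e unfolding continuous_at_eps_delta by (metis half_gt_zero)
    have "\<forall>\<^sub>F n in sequentially. r n < d" using order_tendstoD(2)[OF r d(1)] .
    then show "\<forall>\<^sub>F n in sequentially. dist (\<integral>y. f y \<partial>\<nu> n) (f x) < e"
    proof eventually_elim
      case (elim n)
      interpret prob_space "\<nu> n" using probs_D[OF \<nu>] by simp
      have int: "integrable (\<nu> n) f"
        using f borel_measurable_continuous_onI by (intro integrable_bounded_borel \<nu>) auto
      have "AE y in \<nu> n. f x - e / 2 \<le> f y \<and> f y \<le> f x + e / 2"
        using supp[of n]
      proof eventually_elim
        case (elim y)
        then have "dist (f y) (f x) < e / 2" using d(2)[of y] \<open>r n < d\<close> by (simp add: dist_commute)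
        then show ?case unfolding dist_real_def by linarith
      qed
      then have "f x - e / 2 \<le> (\<integral>y. f y \<partial>\<nu> n)" "(\<integral>y. f y \<partial>\<nu> n) \<le> f x + e / 2"
        using int by (auto intro!: integral_ge_const integral_le_const)
      then show ?case using e unfolding dist_real_def by linarith
    qed
  qed
qed

lemma inverse_Suc_lim:
  assumes "filterlim \<kappa> at_top sequentially"
  shows "(\<lambda>n. 1 / real (Suc (\<kappa> n))) \<longlonglongrightarrow> 0"
  by (rule filterlim_compose[OF LIMSEQ_Suc[OF lim_1_over_n] assms])

section \<open>Entropy\<close>

lemma le_rel_entropy:
  assumes "\<phi> \<in> borel_measurable borel" "bounded (range \<phi>)"
  shows "ereal ((\<integral>x. \<phi> x \<partial>\<nu>) - ln (\<integral>x. exp (\<phi> x) \<partial>\<mu>)) \<le> rel_entropy \<nu> \<mu>"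
  unfolding rel_entropy_def using assms by (intro SUP_upper) auto

text \<open>The alternative covers null sets, on which conditioning is meaningless; it keeps a probability measure
that charges only points of \<open>B\<close> (when \<open>x \<in> B\<close>), so that narrow convergence needs no case
distinction.\<close>

definition conditioned :: "'a::topological_space measure \<Rightarrow> 'a set \<Rightarrow> 'a \<Rightarrow> 'a measure" where
  "conditioned \<mu> B x = (if emeasure \<mu> B = 0 then return borel x else uniform_measure \<mu> B)"

lemma conditioned_in_borel_probs:
  assumes "\<mu> \<in> borel_probs"
  shows "conditioned \<mu> B x \<in> borel_probs"
proof -
  interpret prob_space \<mu> using probs_D[OF assms] by simp
  show ?thesis
    using probs_D[OF assms] return_in_borel_probs prob_space_uniform_measure[of \<mu> B]
    by (auto simp: conditioned_def space_prob_algebra)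
qed

lemma AE_conditioned:
  assumes "\<mu> \<in> borel_probs" "open B" "x \<in> B"
  shows "AE y in conditioned \<mu> B x. y \<in> B"
proof -
  have "AE y in uniform_measure \<mu> B. y \<in> B"
    using probs_D[OF assms(1)] assms(2) by (intro AE_uniform_measureI) auto
  moreover have "AE y in return borel x. y \<in> B"
    using assms(2,3) by (subst AE_return) (auto simp: pred_def)
  ultimately show ?thesis unfolding conditioned_def by (simp split: if_split)
qed

lemma exp_expectation_le:
  fixes \<phi> :: "'a \<Rightarrow> real"
  assumes "prob_space \<nu>" "integrable \<nu> \<phi>" "integrable \<nu> (\<lambda>x. exp (\<phi> x))"
  shows "exp (\<integral>x. \<phi> x \<partial>\<nu>) \<le> (\<integral>x. exp (\<phi> x) \<partial>\<nu>)"
proof -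
  interpret prob_space \<nu> by fact
  have "convex_on UNIV (exp :: real \<Rightarrow> real)" by (rule exp_convex)
  then show ?thesis
    using jensens_inequality[where X = \<phi> and I = UNIV and q = exp] assms by (auto simp: o_def)
qed

text \<open>Conditioning on \<open>B\<close> costs no more than the logarithm of the mass of \<open>B\<close>: the \<open>\<mu>\<close>-integral of
\<open>exp \<phi>\<close> is at least the mass of \<open>B\<close> times its conditional expectation, to which Jensen's inequality
applies.\<close>

lemma rel_entropy_conditioned_le:
  assumes \<mu>: "\<mu> \<in> borel_probs" and B: "open B"
  shows "rel_entropy (conditioned \<mu> B x) \<mu> \<le> decay 1 (emeasure \<mu> B)"
proof (cases "emeasure \<mu> B = 0")
  case True
  then show ?thesis by (simp add: decay_def eln_def)
next
  case False
  interpret prob_space \<mu> using probs_D[OF \<mu>] by simp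
  define \<nu> where "\<nu> = uniform_measure \<mu> B"
  define p where "p = measure \<mu> B"
  have p: "0 < p" "emeasure \<mu> B = ennreal p"
    using False by (simp_all add: p_def emeasure_eq_measure measure_nonneg zero_less_measure_iff)
  have \<nu>_eq: "conditioned \<mu> B x = \<nu>" using False by (simp add: conditioned_def \<nu>_def)
  have \<nu>: "\<nu> \<in> borel_probs" using conditioned_in_borel_probs[OF \<mu>] \<nu>_eq by metis
  have "(\<integral>x. \<phi> x \<partial>\<nu>) - ln (\<integral>x. exp (\<phi> x) \<partial>\<mu>) \<le> - ln p"
    if \<phi>: "\<phi> \<in> borel_measurable borel" "bounded (range \<phi>)" for \<phi>
  proof -
    have int: "integrable \<rho> (\<lambda>x. exp (\<phi> x))" if "\<rho> \<in> borel_probs" for \<rho>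
      using that \<phi> bounded_exp by (intro integrable_bounded_borel) auto
    have [measurable]: "\<phi> \<in> borel_measurable \<mu>"
      using \<phi>(1) probs_D(2)[OF \<mu>] by (simp cong: measurable_cong_sets)
    have [measurable]: "B \<in> sets \<mu>" using B probs_D(2)[OF \<mu>] by simp
    have "ennreal (\<integral>x. exp (\<phi> x) \<partial>\<nu>) = (\<integral>\<^sup>+x. ennreal (exp (\<phi> x)) \<partial>\<nu>)"
      by (rule nn_integral_eq_integral[symmetric]) (use int[OF \<nu>] in auto)
    also have "\<dots> = (\<integral>\<^sup>+x. ennreal (exp (\<phi> x)) * indicator B x \<partial>\<mu>) / ennreal p"
      unfolding \<nu>_def p(2)[symmetric] by (rule nn_integral_uniform_measure) auto
    also have "\<dots> \<le> (\<integral>\<^sup>+x. ennreal (exp (\<phi> x)) \<partial>\<mu>) / ennreal p"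
      by (intro divide_right_mono_ennreal nn_integral_mono) (auto simp: indicator_def)
    also have "(\<integral>\<^sup>+x. ennreal (exp (\<phi> x)) \<partial>\<mu>) = ennreal (\<integral>x. exp (\<phi> x) \<partial>\<mu>)"
      by (rule nn_integral_eq_integral) (use int[OF \<mu>] in auto)
    finally have le: "(\<integral>x. exp (\<phi> x) \<partial>\<nu>) \<le> (\<integral>x. exp (\<phi> x) \<partial>\<mu>) / p"
      using p(1) by (simp add: divide_ennreal integral_nonneg)
    have "exp (\<integral>x. \<phi> x \<partial>\<nu>) \<le> (\<integral>x. exp (\<phi> x) \<partial>\<nu>)"
      using probs_D[OF \<nu>] int[OF \<nu>] integrable_bounded_borel[OF \<nu> \<phi>]
      by (intro exp_expectation_le) auto
    with le have *: "exp (\<integral>x. \<phi> x \<partial>\<nu>) \<le> (\<integral>x. exp (\<phi> x) \<partial>\<mu>) / p" by simp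
    then have pos: "0 < (\<integral>x. exp (\<phi> x) \<partial>\<mu>)"
      using p(1) by (smt (verit) exp_gt_zero zero_less_divide_iff)
    have "(\<integral>x. \<phi> x \<partial>\<nu>) \<le> ln ((\<integral>x. exp (\<phi> x) \<partial>\<mu>) / p)"
      using * p(1) pos by (subst ln_ge_iff) auto
    also have "\<dots> = ln (\<integral>x. exp (\<phi> x) \<partial>\<mu>) - ln p" using pos p(1) by (simp add: ln_div)
    finally show ?thesis by simp
  qed
  then have "rel_entropy \<nu> \<mu> \<le> ereal (- ln p)"
    unfolding rel_entropy_def by (intro SUP_least) auto
  also have "\<dots> = decay 1 (emeasure \<mu> B)" using p by (simp add: decay_def eln_def)
  finally show ?thesis by (simp add: \<nu>_eq)
qed

section \<open>The rate functions\<close>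

lemma ereal_le_of_min_le:
  fixes s t :: ereal
  assumes "0 \<le> t" and le: "\<And>c. 0 \<le> c \<Longrightarrow> min (ereal c) t \<le> s"
  shows "t \<le> s"
proof (cases t)
  case PInf
  have "ereal c \<le> s" for c
  proof -
    have "ereal c \<le> ereal (max c 0)" by simp
    also have "\<dots> \<le> s" using le[of "max c 0"] PInf by simp
    finally show ?thesis .
  qed
  then show ?thesis using PInf by (simp add: ereal_top)
qed (use assms(1) le[of "real_of_ereal t"] in auto)

locale weighted_sequence =
  fixes \<mu> :: "nat \<Rightarrow> 'a::polish_space measure" and a :: "nat \<Rightarrow> real"
  assumes probs: "\<And>n. \<mu> n \<in> borel_probs"
    and a_pos: "\<And>n. 0 < a n"
    and a_lim: "filterlim a at_top sequentially"
begin

lemma over_a_lim: "(\<lambda>n. r / a n) \<longlonglongrightarrow> 0"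
  by (rule real_tendsto_divide_at_top[OF tendsto_const a_lim])

definition cost :: "nat \<Rightarrow> 'a set \<Rightarrow> ereal" where
  "cost n U = decay (a n) (emeasure (\<mu> n) U)"

text \<open>Costs grow as the neighbourhood shrinks, so this supremum is the limit along any neighbourhood base
of \<open>x\<close>. With all open neighbourhoods, lower semicontinuity and independence of the chosen
distance are built in.\<close>

definition rate :: "((nat \<Rightarrow> ereal) \<Rightarrow> ereal) \<Rightarrow> 'a \<Rightarrow> ereal" where
  "rate L x = (SUP U \<in> {U. open U \<and> x \<in> U}. L (\<lambda>n. cost n U))"

lemma cost_nonneg: "0 \<le> cost n U"
proof -
  interpret prob_space "\<mu> n" using probs_D[OF probs] by simp
  show ?thesis unfolding cost_def by (intro decay_nonneg a_pos) (simp add: emeasure_le_1)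
qed

lemma cost_antimono:
  assumes "U \<subseteq> W" "open W \<or> closed W"
  shows "cost n W \<le> cost n U"
  unfolding cost_def
  using assms probs_D(2)[OF probs, of n] by (intro decay_antimono a_pos emeasure_mono) auto

lemma le_cost_iff: "ereal c \<le> cost n U \<longleftrightarrow> emeasure (\<mu> n) U \<le> ennreal (exp (- (a n * c)))"
  unfolding cost_def by (rule le_decay_iff[OF a_pos])

lemma rate_nonneg:
  assumes "lim_mode L"
  shows "0 \<le> rate L x"
proof -
  have "0 \<le> L (\<lambda>n. cost n UNIV)" by (rule lim_mode_nonneg[OF assms cost_nonneg])
  also have "\<dots> \<le> rate L x" unfolding rate_def by (rule SUP_upper) auto
  finally show ?thesis .
qed

lemma rate_lsc_rate:
  assumes "lim_mode L"
  shows "lsc_rate (rate L)"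
proof -
  have "open {x. c < rate L x}" for c
  proof (subst open_subopen, intro ballI)
    fix x assume "x \<in> {x. c < rate L x}"
    then obtain U where U: "open U" "x \<in> U" "c < L (\<lambda>n. cost n U)"
      unfolding rate_def less_SUP_iff by auto
    then have "U \<subseteq> {x. c < rate L x}" unfolding rate_def less_SUP_iff by auto
    then show "\<exists>T. open T \<and> x \<in> T \<and> T \<subseteq> {x. c < rate L x}" using U by blast
  qed
  moreover have "- {x. rate L x \<le> c} = {x. c < rate L x}" for c by auto
  ultimately have "lsc (rate L)" unfolding lsc_def closed_def by simp
  then show ?thesis using rate_nonneg[OF assms] by (simp add: lsc_rate_def)
qed

lemma rate_limit_balls:
  fixes D :: "'a metric"
  assumes L: "lim_mode L" and D: "mtopology_of D = euclidean"
  shows "((\<lambda>\<delta>. L (\<lambda>n. ereal (- 1 / a n) * eln (emeasure (\<mu> n) (mball_of D x \<delta>)))) \<longlongrightarrow> rate L x)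
    (at_right 0)"
proof -
  interpret M: Metric_space "mspace D" "mdist D" by simp
  have top: "openin M.mtopology U = open U" for U
    unfolding open_openin D[symmetric] mtopology_of_def ..
  have space: "mspace D = UNIV" using topspace_mtopology_of[of D] D by simp
  have ball: "mball_of D x \<delta> = M.mball x \<delta>" for \<delta> by (simp add: mball_of_def)
  have opn: "open (mball_of D x \<delta>)" for \<delta>
    using M.openin_mball[of x \<delta>] by (simp add: top ball)
  have "((\<lambda>\<delta>. L (\<lambda>n. cost n (mball_of D x \<delta>))) \<longlongrightarrow> rate L x) (at_right 0)"
  proof (rule order_tendstoI)
    fix l assume "l < rate L x"
    then obtain U where U: "open U" "x \<in> U" "l < L (\<lambda>n. cost n U)"
      unfolding rate_def less_SUP_iff by auto
    then obtain r where r: "r > 0" "M.mball x r \<subseteq> U"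
      using top[of U] unfolding M.openin_mtopology by blast
    have "l < L (\<lambda>n. cost n (mball_of D x \<delta>))" if "\<delta> < r" for \<delta>
    proof -
      have "mball_of D x \<delta> \<subseteq> U" using r that by (auto simp: ball)
      then have "L (\<lambda>n. cost n U) \<le> L (\<lambda>n. cost n (mball_of D x \<delta>))"
        using U(1) by (intro lim_mode_mono[OF L]) (simp add: cost_antimono)
      with U(3) show ?thesis by simp
    qed
    then show "\<forall>\<^sub>F \<delta> in at_right 0. l < L (\<lambda>n. cost n (mball_of D x \<delta>))"
      using r(1) unfolding eventually_at_right_field by blast
  next
    fix u assume u: "rate L x < u"
    have "L (\<lambda>n. cost n (mball_of D x \<delta>)) < u" if "\<delta> > 0" for \<delta>
    proof -
      have "L (\<lambda>n. cost n (mball_of D x \<delta>)) \<le> rate L x"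
        unfolding rate_def using opn that space by (intro SUP_upper) auto
      with u show ?thesis by simp
    qed
    then show "\<forall>\<^sub>F \<delta> in at_right 0. L (\<lambda>n. cost n (mball_of D x \<delta>)) < u"
      by (intro eventually_at_right_less[THEN eventually_mono]) auto
  qed
  then show ?thesis by (simp add: cost_def decay_def)
qed

section \<open>Lower estimates\<close>

lemma bump:
  fixes x :: 'a
  assumes "open U" "x \<in> U"
  obtains f :: "'a \<Rightarrow> real" where "continuous_on UNIV f" "\<And>y. 0 \<le> f y" "\<And>y. f y \<le> 1" "f x = 1"
    "\<And>y. y \<notin> U \<Longrightarrow> f y = 0"
proof -
  obtain r where r: "r > 0" "ball x r \<subseteq> U" using assms openE by blast
  show ?thesis
  proof
    show "continuous_on UNIV (\<lambda>y. max 0 (1 - dist x y / r))" by (intro continuous_intros) (use r in auto)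
    show "max 0 (1 - dist x y / r) = 0" if "y \<notin> U" for y
    proof -
      have "r \<le> dist x y" using that r(2) by (auto simp: subset_iff not_less)
      then show ?thesis using r(1) by (simp add: field_simps)
    qed
  qed (use r in auto)
qed

definition log_mgf :: "('a \<Rightarrow> real) \<Rightarrow> nat \<Rightarrow> real" where
  "log_mgf \<phi> n = ln (\<integral>y. exp (a n * \<phi> y) \<partial>\<mu> n) / a n"

lemma integrable_tilt:
  assumes "\<phi> \<in> borel_measurable borel" "bounded (range (\<phi> :: 'a \<Rightarrow> real))"
  shows "integrable (\<mu> n) (\<lambda>y. exp (a n * \<phi> y))"
proof -
  have "range (\<lambda>y. a n * \<phi> y) = (\<lambda>t. a n *\<^sub>R t) ` range \<phi>" by auto
  then have "bounded (range (\<lambda>y. a n * \<phi> y))" using bounded_scaling[OF assms(2)] by simp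
  from bounded_exp[OF this] show ?thesis
    using assms(1) by (intro integrable_bounded_borel probs) auto
qed

lemma integral_tilt_pos:
  assumes "\<phi> \<in> borel_measurable borel" "bounded (range (\<phi> :: 'a \<Rightarrow> real))"
  shows "0 < (\<integral>y. exp (a n * \<phi> y) \<partial>\<mu> n)"
proof -
  interpret prob_space "\<mu> n" using probs_D[OF probs] by simp
  have "(\<integral>y. exp (a n * \<phi> y) \<partial>\<mu> n) \<noteq> 0"
  proof
    assume "(\<integral>y. exp (a n * \<phi> y) \<partial>\<mu> n) = 0"
    then have "AE y in \<mu> n. exp (a n * \<phi> y) = 0"
      using integral_nonneg_eq_0_iff_AE[OF integrable_tilt[OF assms, of n]] by simp
    then show False by simp
  qed
  moreover have "0 \<le> (\<integral>y. exp (a n * \<phi> y) \<partial>\<mu> n)" by (rule Bochner_Integration.integral_nonneg) simp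
  ultimately show ?thesis by linarith
qed

text \<open>The exponential of \<open>a n * c * f\<close> is at most \<open>1\<close> off \<open>U\<close> and \<open>exp (a n * c)\<close> on \<open>U\<close>, so its integral
is at most twice the larger of \<open>1\<close> and \<open>exp (a n * c)\<close> times the mass of \<open>U\<close>. Truncating the cost at
\<open>c\<close> merges the two cases into one inequality, valid for every \<open>n\<close>; this is what allows the same
argument for upper and for lower limits.\<close>

lemma log_mgf_bump_le:
  fixes f :: "'a \<Rightarrow> real"
  assumes f: "f \<in> borel_measurable borel" "\<And>y. 0 \<le> f y" "\<And>y. f y \<le> 1" "\<And>y. y \<notin> U \<Longrightarrow> f y = 0"
    and U: "open U" and c: "0 \<le> c"
  shows "min (ereal c) (cost n U) \<le> ereal (c - log_mgf (\<lambda>y. c * f y) n + ln 2 / a n)"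
proof -
  interpret prob_space "\<mu> n" using probs_D[OF probs] by simp
  have a: "0 < a n" by (rule a_pos)
  have [measurable]: "U \<in> sets (\<mu> n)" using U probs_D(2)[OF probs] by simp
  obtain m where m_eq: "min (ereal c) (cost n U) = ereal m"
    using cost_nonneg[of n U] by (cases "cost n U"; cases "ereal c \<le> cost n U") (auto simp: min_def)
  have m: "m \<le> c" "ereal m \<le> cost n U"
    using min.cobounded1[of "ereal c" "cost n U"] min.cobounded2[of "ereal c" "cost n U"] m_eq by auto
  have mU: "measure (\<mu> n) U \<le> exp (- (a n * m))"
    using m(2) by (simp add: le_cost_iff emeasure_eq_measure)
  define J where "J = (\<integral>y. exp (a n * (c * f y)) \<partial>\<mu> n)"
  have cf: "(\<lambda>y. c * f y) \<in> borel_measurable borel" "bounded (range (\<lambda>y. c * f y))"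
  proof -
    have "norm (c * f y) \<le> c" for y using f(2,3)[of y] c by (simp add: mult_left_le)
    then show "bounded (range (\<lambda>y. c * f y))" unfolding bounded_iff by blast
  qed (use f(1) in simp)
  have "J \<le> (\<integral>y. 1 + exp (a n * c) * indicator U y \<partial>\<mu> n)"
    unfolding J_def
  proof (rule integral_mono)
    show "integrable (\<mu> n) (\<lambda>y. exp (a n * (c * f y)))" by (rule integrable_tilt[OF cf])
    show "integrable (\<mu> n) (\<lambda>y. 1 + exp (a n * c) * indicator U y)" by (simp add: emeasure_eq_measure)
    show "exp (a n * (c * f y)) \<le> 1 + exp (a n * c) * indicator U y" for y
    proof (cases "y \<in> U")
      case True
      have "a n * (c * f y) \<le> a n * c" using a c f(3)[of y] by (simp add: mult_left_le)
      then have "exp (a n * (c * f y)) \<le> exp (a n * c)" by simp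
      with True show ?thesis by (simp add: add_increasing)
    qed (simp add: f(4))
  qed
  also have "\<dots> = 1 + exp (a n * c) * measure (\<mu> n) U"
    using prob_space by (simp add: emeasure_eq_measure)
  also have "\<dots> \<le> 1 + exp (a n * c) * exp (- (a n * m))" using mU by simp
  also have "\<dots> = 1 + exp (a n * (c - m))" by (simp add: exp_add[symmetric] algebra_simps)
  also have "\<dots> \<le> 2 * exp (a n * (c - m))" using a m(1) by simp
  finally have J: "J \<le> 2 * exp (a n * (c - m))" .
  have "0 < J" unfolding J_def by (rule integral_tilt_pos[OF cf])
  then have "ln J \<le> ln (2 * exp (a n * (c - m)))" using J by simp
  also have "\<dots> = ln 2 + a n * (c - m)" by (simp add: ln_mult)
  finally have "ln J / a n \<le> ln 2 / a n + (c - m)"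
    using a by (simp add: field_simps)
  then show ?thesis using m_eq unfolding log_mgf_def J_def by simp
qed

lemma tilt_le_scaled_entropy:
  assumes "\<phi> \<in> borel_measurable borel" "bounded (range (\<phi> :: 'a \<Rightarrow> real))"
  shows "ereal ((\<integral>y. \<phi> y \<partial>\<nu>) - log_mgf \<phi> n) \<le> scaled_entropy \<mu> a n \<nu>"
proof -
  have "range (\<lambda>y. a n * \<phi> y) = (\<lambda>t. a n *\<^sub>R t) ` range \<phi>" by auto
  then have "bounded (range (\<lambda>y. a n * \<phi> y))" using bounded_scaling[OF assms(2)] by simp
  then have "ereal (a n * (\<integral>y. \<phi> y \<partial>\<nu>) - ln (\<integral>y. exp (a n * \<phi> y) \<partial>\<mu> n)) \<le> rel_entropy \<nu> (\<mu> n)"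
    using le_rel_entropy[of "\<lambda>y. a n * \<phi> y" \<nu> "\<mu> n"] assms(1) by simp
  then have "ereal (1 / a n) * ereal (a n * (\<integral>y. \<phi> y \<partial>\<nu>) - ln (\<integral>y. exp (a n * \<phi> y) \<partial>\<mu> n))
      \<le> scaled_entropy \<mu> a n \<nu>"
    unfolding scaled_entropy_def using a_pos[of n] by (intro ereal_mult_left_mono) auto
  then show ?thesis using a_pos[of n] by (simp add: log_mgf_def field_simps)
qed

text \<open>Subtracting the normalising constant from \<open>c * f\<close> gives a member of the smallest of the six classes of
test sequences.\<close>

lemma test_sequence_of_bump:
  fixes f :: "'a \<Rightarrow> real"
  assumes f: "continuous_on UNIV f" "\<And>y. 0 \<le> f y" "\<And>y. f y \<le> 1" and c: "0 \<le> c"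
  defines "V \<equiv> \<lambda>n y. ereal (c * f y - log_mgf (\<lambda>y. c * f y) n)"
  shows "cont_bounded_seq V" "exp_integral_eq_1 \<mu> a V"
proof -
  have cfb: "norm (c * f y) \<le> c" for y using f(2,3)[of y] c by (simp add: mult_left_le)
  then have cf: "(\<lambda>y. c * f y) \<in> borel_measurable borel" "bounded (range (\<lambda>y. c * f y))"
    using borel_measurable_continuous_onI[OF f(1)] unfolding bounded_iff by auto
  have "continuous_on UNIV (V n)" for n
    unfolding V_def by (intro continuous_intros continuous_on_ereal f(1))
  moreover have "\<bar>V n y\<bar> \<le> ereal (c + \<bar>log_mgf (\<lambda>y. c * f y) n\<bar>)" for n y
    using cfb[of y] by (simp add: V_def)
  ultimately show "cont_bounded_seq V" unfolding cont_bounded_seq_def by blast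
  have "exp_integral \<mu> a V n = 1" for n
  proof -
    define J where "J = (\<integral>y. exp (a n * (c * f y)) \<partial>\<mu> n)"
    have J: "0 < J" unfolding J_def by (rule integral_tilt_pos[OF cf])
    have "eexp (ereal (a n) * V n y) = ennreal (exp (a n * (c * f y)) / J)" for y
    proof -
      have "a n * (c * f y - log_mgf (\<lambda>y. c * f y) n) = a n * (c * f y) - ln J"
        using a_pos[of n] by (simp add: log_mgf_def J_def field_simps)
      then show ?thesis using J by (simp add: eexp_def V_def exp_diff)
    qed
    then have "exp_integral \<mu> a V n = (\<integral>\<^sup>+y. ennreal (exp (a n * (c * f y)) / J) \<partial>\<mu> n)"
      by (simp add: exp_integral_def)
    also have "\<dots> = ennreal (\<integral>y. exp (a n * (c * f y)) / J \<partial>\<mu> n)"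
      using integrable_tilt[OF cf] J by (intro nn_integral_eq_integral) auto
    also have "\<dots> = 1" using J by (simp add: J_def)
    finally show ?thesis .
  qed
  then show "exp_integral_eq_1 \<mu> a V" by (simp add: exp_integral_eq_1_def)
qed

text \<open>The common core of both lower estimates. The number \<open>t n\<close> is the integral of the bump \<open>f\<close> against a
measure close to the Dirac mass at the peak of \<open>f\<close>, or the value of \<open>f\<close> at a point close to the peak.\<close>

lemma min_cost_le_lim:
  fixes f :: "'a \<Rightarrow> real"
  assumes L: "lim_mode L"
    and f: "f \<in> borel_measurable borel" "\<And>y. 0 \<le> f y" "\<And>y. f y \<le> 1" "\<And>y. y \<notin> U \<Longrightarrow> f y = 0"
    and U: "open U" and c: "0 \<le> c"
    and t: "t \<longlonglongrightarrow> 1" and G: "\<And>n. ereal (c * t n - log_mgf (\<lambda>y. c * f y) n) \<le> G n"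
  shows "min (ereal c) (L (\<lambda>n. cost n U)) \<le> L G"
proof -
  \<comment> \<open>The error left by \<open>t n\<close> not being exactly \<open>1\<close> and by the factor \<open>2\<close> in the integral.\<close>
  define e where "e n = ereal (c * (1 - t n) + ln 2 / a n)" for n
  have "(\<lambda>n. c * (1 - t n) + ln 2 / a n) \<longlonglongrightarrow> c * (1 - 1) + 0"
    by (intro tendsto_intros t over_a_lim)
  then have e: "e \<longlonglongrightarrow> 0" unfolding e_def zero_ereal_def by (intro tendsto_ereal) simp
  have "min (ereal c) (cost n U) \<le> G n + e n" for n
  proof -
    have "min (ereal c) (cost n U) \<le> ereal (c - log_mgf (\<lambda>y. c * f y) n + ln 2 / a n)"
      by (rule log_mgf_bump_le) (use f U c in auto)
    also have "\<dots> = ereal (c * t n - log_mgf (\<lambda>y. c * f y) n) + e n"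
      by (simp add: e_def algebra_simps)
    also have "\<dots> \<le> G n + e n" by (intro add_right_mono G)
    finally show ?thesis .
  qed
  then have "L (\<lambda>n. min (ereal c) (cost n U)) \<le> L (\<lambda>n. G n + e n)"
    by (intro lim_mode_mono[OF L]) simp
  then show ?thesis by (simp add: lim_mode_min[OF L] lim_mode_add_null[OF L e])
qed

lemma rate_leI:
  assumes L: "lim_mode L"
    and *: "\<And>U c. open U \<Longrightarrow> x \<in> U \<Longrightarrow> 0 \<le> c \<Longrightarrow> min (ereal c) (L (\<lambda>n. cost n U)) \<le> s"
  shows "rate L x \<le> s"
  unfolding rate_def
proof (rule SUP_least, rule ereal_le_of_min_le)
  show "0 \<le> L (\<lambda>n. cost n U)" for U by (rule lim_mode_nonneg[OF L cost_nonneg])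
qed (use * in auto)

text \<open>The tilted bump is an admissible test function in the variational formula for the entropy. As the
bump is continuous, its integrals against \<open>\<nu> n\<close> converge to its value \<open>1\<close> at \<open>x\<close>.\<close>

lemma rate_le_Gamma_entropy:
  assumes L: "lim_mode L"
  shows "rate L x \<le> Gamma_lim L narrow_topology (scaled_entropy \<mu> a) (return borel x)"
  unfolding Gamma_lim_def
proof (rule INF_greatest, elim CollectE conjE)
  fix \<nu> :: "nat \<Rightarrow> 'a measure"
  assume "\<forall>n. \<nu> n \<in> topspace narrow_topology"
    and lim: "limitin narrow_topology \<nu> (return borel x) sequentially"
  then have \<nu>: "\<And>n. \<nu> n \<in> borel_probs" by simp
  show "rate L x \<le> L (\<lambda>n. scaled_entropy \<mu> a n (\<nu> n))"
  proof (rule rate_leI[OF L])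
    fix U c assume U: "open U" "x \<in> U" and c: "0 \<le> (c :: real)"
    obtain f :: "'a \<Rightarrow> real" where f: "continuous_on UNIV f" "\<And>y. 0 \<le> f y" "\<And>y. f y \<le> 1" "f x = 1"
      "\<And>y. y \<notin> U \<Longrightarrow> f y = 0" using bump[OF U] by blast
    have fm: "f \<in> borel_measurable borel" by (rule borel_measurable_continuous_onI[OF f(1)])
    have "norm (f y) \<le> 1" "norm (c * f y) \<le> c" for y
      using f(2,3)[of y] c by (simp_all add: mult_left_le)
    then have b: "bounded (range f)" "bounded (range (\<lambda>y. c * f y))" unfolding bounded_iff by blast+
    have t: "(\<lambda>n. \<integral>y. f y \<partial>\<nu> n) \<longlonglongrightarrow> 1"
      using lim f(1,4) b(1) unfolding narrow_lim_return_iff[OF \<nu>] by metis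
    show "min (ereal c) (L (\<lambda>n. cost n U)) \<le> L (\<lambda>n. scaled_entropy \<mu> a n (\<nu> n))"
    proof (rule min_cost_le_lim[OF L fm f(2,3,5) U(1) c t])
      show "ereal (c * (\<integral>y. f y \<partial>\<nu> n) - log_mgf (\<lambda>y. c * f y) n) \<le> scaled_entropy \<mu> a n (\<nu> n)" for n
        using tilt_le_scaled_entropy[of "\<lambda>y. c * f y" "\<nu> n" n] fm b(2) by simp
    qed
  qed
qed

lemma rate_le_test_sequences:
  assumes L: "lim_mode L"
    and cls: "\<And>V. cont_bounded_seq V \<Longrightarrow> exp_integral_eq_1 \<mu> a V \<Longrightarrow> P V"
  shows "rate L x \<le> (SUP V \<in> {V. P V}. Gamma_lim L euclidean V x)"
proof (rule rate_leI[OF L])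
  fix U c assume U: "open U" "x \<in> U" and c: "0 \<le> (c :: real)"
  obtain f :: "'a \<Rightarrow> real" where f: "continuous_on UNIV f" "\<And>y. 0 \<le> f y" "\<And>y. f y \<le> 1" "f x = 1"
    "\<And>y. y \<notin> U \<Longrightarrow> f y = 0" using bump[OF U] by blast
  have fm: "f \<in> borel_measurable borel" by (rule borel_measurable_continuous_onI[OF f(1)])
  define V where "V n y = ereal (c * f y - log_mgf (\<lambda>y. c * f y) n)" for n y
  have "P V"
    using test_sequence_of_bump[OF f(1,2,3) c] by (intro cls) (simp_all add: V_def[abs_def])
  have "min (ereal c) (L (\<lambda>n. cost n U)) \<le> Gamma_lim L euclidean V x"
    unfolding Gamma_lim_def
  proof (rule INF_greatest, elim CollectE conjE)
    fix z :: "nat \<Rightarrow> 'a" assume "limitin euclidean z x sequentially"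
    then have t: "(\<lambda>n. f (z n)) \<longlonglongrightarrow> 1"
      using continuous_on_tendsto_compose[OF f(1), of z x] f(4) by simp
    show "min (ereal c) (L (\<lambda>n. cost n U)) \<le> L (\<lambda>n. V n (z n))"
    proof (rule min_cost_le_lim[OF L fm f(2,3,5) U(1) c t])
      show "ereal (c * f (z n) - log_mgf (\<lambda>y. c * f y) n) \<le> V n (z n)" for n
        by (simp add: V_def)
    qed
  qed
  also have "\<dots> \<le> (SUP V \<in> {V. P V}. Gamma_lim L euclidean V x)"
    using \<open>P V\<close> by (intro SUP_upper) simp
  finally show "min (ereal c) (L (\<lambda>n. cost n U)) \<le> (SUP V \<in> {V. P V}. Gamma_lim L euclidean V x)" .
qed

end

section \<open>Upper estimates\<close>

lemma eexp_mono: "v \<le> w \<Longrightarrow> eexp v \<le> eexp w"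
  by (cases v; cases w) (auto simp: eexp_def)

lemma eln_mono:
  assumes "s \<le> t"
  shows "eln s \<le> eln t"
  using decay_antimono[OF zero_less_one assms] unfolding decay_def
  by (cases "eln s"; cases "eln t") auto

text \<open>This inequality also holds for the infinite values, because a sum of \<open>\<infinity>\<close> and \<open>- \<infinity>\<close> is \<open>\<infinity>\<close> for
extended reals: a null event imposes no bound on \<open>i\<close>.\<close>

lemma le_decay_add_eln:
  assumes a: "0 < a" and le: "eexp (ereal a * i) * t \<le> M" and t: "t \<noteq> \<infinity>"
  shows "i \<le> decay a t + ereal (1 / a) * eln M"
proof (cases "t = 0 \<or> M = \<infinity>")
  case True
  then show ?thesis using a by (auto simp: decay_def eln_def)
next
  case False
  then obtain r m where rm: "t = ennreal r" "0 < r" "M = ennreal m" "0 \<le> m"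
    using t by (cases t; cases M) auto
  show ?thesis
  proof (cases i)
    case (real k)
    have "ennreal (exp (a * k) * r) \<le> ennreal m"
      using le rm real by (simp add: eexp_def ennreal_mult)
    then have m: "exp (a * k) * r \<le> m" using rm by simp
    then have pos: "0 < m" using rm(2) by (smt (verit) exp_gt_zero mult_pos_pos)
    have "ln (exp (a * k) * r) \<le> ln m" using m rm(2) pos by (subst ln_le_cancel_iff) auto
    then have "a * k + ln r \<le> ln m" using rm(2) by (simp add: ln_mult)
    then have "k \<le> - ln r / a + ln m / a" using a by (simp add: field_simps)
    then show ?thesis using real rm pos by (simp add: decay_def eln_def)
  next
    case PInf
    then have "M = \<infinity>" using le a rm by (simp add: eexp_def ennreal_top_mult top_unique)
    then show ?thesis using False by simp
  qed simp
qed

context weighted_sequence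
begin

lemma L_cost_ball_le_rate:
  "(SUP k. L (\<lambda>n. cost n (ball x (1 / real (Suc k))))) \<le> rate L x"
  unfolding rate_def by (intro SUP_least SUP_upper) auto

text \<open>One sequence of balls around \<open>x\<close> whose radii tend to \<open>0\<close> and whose costs are asymptotically at most
the rate at \<open>x\<close>. Every approximating sequence below is taken from such balls.\<close>

lemma shrinking_balls:
  assumes L: "lim_mode L"
  obtains \<kappa> where "filterlim \<kappa> at_top sequentially"
    "L (\<lambda>n. cost n (ball x (1 / real (Suc (\<kappa> n))))) \<le> rate L x"
proof -
  obtain \<kappa> where "filterlim \<kappa> at_top sequentially"
    "L (\<lambda>n. cost n (ball x (1 / real (Suc (\<kappa> n)))))
      \<le> (SUP k. L (\<lambda>n. cost n (ball x (1 / real (Suc k)))))"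
    using lim_mode_diagonal[OF L, of "\<lambda>k n. cost n (ball x (1 / real (Suc k)))"] cost_nonneg
    by blast
  then show ?thesis using that order_trans[OF _ L_cost_ball_le_rate] by blast
qed

lemma scaled_entropy_conditioned_le:
  assumes "open B"
  shows "scaled_entropy \<mu> a n (conditioned (\<mu> n) B x) \<le> cost n B"
proof -
  have "scaled_entropy \<mu> a n (conditioned (\<mu> n) B x) \<le> ereal (1 / a n) * decay 1 (emeasure (\<mu> n) B)"
    unfolding scaled_entropy_def using a_pos[of n]
    by (intro ereal_mult_left_mono rel_entropy_conditioned_le probs assms) auto
  also have "\<dots> = cost n B"
    using a_pos[of n] unfolding cost_def decay_def
    by (cases "eln (emeasure (\<mu> n) B)") auto
  finally show ?thesis .
qed

text \<open>The measures \<open>\<mu> n\<close> conditioned on the shrinking balls form a recovery sequence.\<close>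

lemma Gamma_entropy_le_rate:
  assumes L: "lim_mode L"
  shows "Gamma_lim L narrow_topology (scaled_entropy \<mu> a) (return borel x) \<le> rate L x"
proof -
  obtain \<kappa> where \<kappa>: "filterlim \<kappa> at_top sequentially"
    "L (\<lambda>n. cost n (ball x (1 / real (Suc (\<kappa> n))))) \<le> rate L x"
    using shrinking_balls[OF L] by blast
  define \<nu> where "\<nu> n = conditioned (\<mu> n) (ball x (1 / real (Suc (\<kappa> n)))) x" for n
  have \<nu>: "\<nu> n \<in> borel_probs" for n unfolding \<nu>_def by (intro conditioned_in_borel_probs probs)
  have lim: "limitin narrow_topology \<nu> (return borel x) sequentially"
  proof (rule narrow_lim_return_shrinking[OF \<nu> _ inverse_Suc_lim[OF \<kappa>(1)]])
    show "AE y in \<nu> n. y \<in> ball x (1 / real (Suc (\<kappa> n)))" for n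
      unfolding \<nu>_def by (intro AE_conditioned probs) auto
  qed
  have "Gamma_lim L narrow_topology (scaled_entropy \<mu> a) (return borel x)
      \<le> L (\<lambda>n. scaled_entropy \<mu> a n (\<nu> n))"
    unfolding Gamma_lim_def using lim \<nu> by (intro INF_lower) auto
  also have "\<dots> \<le> L (\<lambda>n. cost n (ball x (1 / real (Suc (\<kappa> n)))))"
    unfolding \<nu>_def
    by (intro lim_mode_mono[OF L] always_eventually allI scaled_entropy_conditioned_le open_ball)
  also have "\<dots> \<le> rate L x" by (rule \<kappa>(2))
  finally show ?thesis .
qed

text \<open>Chebyshev's inequality: the exponential integral is at least the mass of \<open>B\<close> times the infimum
of the integrand on \<open>B\<close>.\<close>

lemma INF_le_cost_add:
  assumes "open B"
  shows "(INF y\<in>B. V n y) \<le> cost n B + ereal (1 / a n) * eln (exp_integral \<mu> a V n)"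
  unfolding cost_def
proof (rule le_decay_add_eln[OF a_pos])
  interpret prob_space "\<mu> n" using probs_D[OF probs] by simp
  show "emeasure (\<mu> n) B \<noteq> \<infinity>" by simp
  have B: "B \<in> sets (\<mu> n)" using assms probs_D(2)[OF probs] by simp
  define i where "i = (INF y\<in>B. V n y)"
  have "eexp (ereal (a n) * i) * emeasure (\<mu> n) B
      = (\<integral>\<^sup>+y. eexp (ereal (a n) * i) * indicator B y \<partial>\<mu> n)"
    by (rule nn_integral_cmult_indicator[OF B, symmetric])
  also have "\<dots> \<le> exp_integral \<mu> a V n"
    unfolding exp_integral_def
  proof (rule nn_integral_mono)
    fix y
    show "eexp (ereal (a n) * i) * indicator B y \<le> eexp (ereal (a n) * V n y)"
    proof (cases "y \<in> B")
      case True
      then have "i \<le> V n y" unfolding i_def by (rule INF_lower)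
      then show ?thesis
        using True a_pos[of n] by (auto intro!: eexp_mono ereal_mult_left_mono)
    qed simp
  qed
  finally show "eexp (ereal (a n) * i) * emeasure (\<mu> n) B \<le> exp_integral \<mu> a V n" .
qed

text \<open>Replacing the normalised logarithm by its positive part \<open>l\<close> excludes the value \<open>- \<infinity>\<close>, so the slack
\<open>e\<close> gives a strict inequality whenever the right-hand side is finite; otherwise any point will do.\<close>

lemma near_infimum:
  fixes V :: "nat \<Rightarrow> 'a \<Rightarrow> ereal" and n :: nat
  assumes "open B" "x \<in> B" and e: "0 < e"
  defines "l \<equiv> max (ereal (1 / a n) * eln (exp_integral \<mu> a V n)) 0"
  shows "\<exists>y\<in>B. V n y \<le> cost n B + (l + ereal e)"
proof (rule ccontr)
  assume "\<not> ?thesis"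
  then have above: "cost n B + (l + ereal e) < V n y" if "y \<in> B" for y using that by auto
  then have fin: "cost n B \<noteq> \<infinity>" "l \<noteq> \<infinity>" using assms(2) by force+
  have nonneg: "0 \<le> l" unfolding l_def by simp
  have "cost n B + (l + ereal e) \<le> (INF y\<in>B. V n y)"
    using above by (intro INF_greatest less_imp_le)
  also have "\<dots> \<le> cost n B + ereal (1 / a n) * eln (exp_integral \<mu> a V n)"
    by (rule INF_le_cost_add[OF assms(1)])
  also have "\<dots> \<le> cost n B + l" unfolding l_def by (intro add_left_mono) simp
  finally show False using fin nonneg e cost_nonneg[of n B] by (cases "cost n B"; cases l) auto
qed

text \<open>In each shrinking ball there is a point at which \<open>V n\<close> nearly attains its infimum; these points
converge to \<open>x\<close>.\<close>

lemma Gamma_test_le_rate: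
  assumes L: "lim_mode L" and V: "exp_integral_limsup \<mu> a V"
  shows "Gamma_lim L euclidean V x \<le> rate L x"
proof -
  obtain \<kappa> where \<kappa>: "filterlim \<kappa> at_top sequentially"
    "L (\<lambda>n. cost n (ball x (1 / real (Suc (\<kappa> n))))) \<le> rate L x"
    using shrinking_balls[OF L] by blast
  define B where "B n = ball x (1 / real (Suc (\<kappa> n)))" for n
  define l where "l n = max (ereal (1 / a n) * eln (exp_integral \<mu> a V n)) 0" for n
  define e where "e n = l n + ereal (1 / real (Suc n))" for n
  have "l \<longlonglongrightarrow> 0"
  proof (rule order_tendstoI)
    fix u :: ereal assume u: "0 < u"
    then have "limsup (\<lambda>n. ereal (1 / a n) * eln (exp_integral \<mu> a V n)) < u"
      using V unfolding exp_integral_limsup_def by (rule order_le_less_trans[rotated])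
    then show "\<forall>\<^sub>F n in sequentially. l n < u"
      by (rule eventually_mono[OF Limsup_lessD]) (simp add: l_def u)
  qed (simp add: l_def less_max_iff_disj)
  then have "(\<lambda>n. l n + ereal (1 / real (Suc n))) \<longlonglongrightarrow> 0 + ereal 0"
    by (intro tendsto_add_ereal tendsto_ereal LIMSEQ_Suc[OF lim_1_over_n]) auto
  then have e: "e \<longlonglongrightarrow> 0" unfolding e_def by (simp add: zero_ereal_def[symmetric])
  have "\<exists>y\<in>B n. V n y \<le> cost n (B n) + e n" for n
    unfolding e_def l_def by (rule near_infimum[of _ x]) (auto simp: B_def)
  then obtain z where z: "\<And>n. z n \<in> B n" "\<And>n. V n (z n) \<le> cost n (B n) + e n" by metis
  have "z \<longlonglongrightarrow> x"
  proof (rule metric_tendsto_imp_tendsto[OF inverse_Suc_lim[OF \<kappa>(1)]])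
    show "\<forall>\<^sub>F n in sequentially. dist (z n) x \<le> dist (1 / real (Suc (\<kappa> n))) 0"
      using z(1) by (intro always_eventually allI) (simp add: B_def dist_commute less_imp_le)
  qed
  then have "Gamma_lim L euclidean V x \<le> L (\<lambda>n. V n (z n))"
    unfolding Gamma_lim_def by (intro INF_lower) auto
  also have "\<dots> \<le> L (\<lambda>n. cost n (B n) + e n)" by (intro lim_mode_mono[OF L]) (simp add: z(2))
  also have "\<dots> = L (\<lambda>n. cost n (B n))" by (rule lim_mode_add_null[OF L e])
  also have "\<dots> \<le> rate L x" using \<kappa>(2) by (simp add: B_def)
  finally show ?thesis .
qed

section \<open>Representations of the rate functions\<close>

lemma rate_eq_Gamma_entropy:
  assumes "lim_mode L"
  shows "rate L x = Gamma_lim L narrow_topology (scaled_entropy \<mu> a) (return borel x)"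
  by (intro antisym rate_le_Gamma_entropy Gamma_entropy_le_rate assms)

lemma exp_integral_le_1_imp_limsup:
  assumes "exp_integral_le_1 \<mu> a V"
  shows "exp_integral_limsup \<mu> a V"
  unfolding exp_integral_limsup_def
proof (rule Limsup_bounded, rule always_eventually, rule allI)
  fix n
  have "eln (exp_integral \<mu> a V n) \<le> eln 1"
    using assms unfolding exp_integral_le_1_def by (intro eln_mono) simp
  then have "eln (exp_integral \<mu> a V n) \<le> 0" by (simp add: eln_def zero_ereal_def)
  then have "ereal (1 / a n) * eln (exp_integral \<mu> a V n) \<le> ereal (1 / a n) * 0"
    using a_pos[of n] by (intro ereal_mult_left_mono) auto
  then show "ereal (1 / a n) * eln (exp_integral \<mu> a V n) \<le> 0" by simp
qed

lemma cont_bounded_imp_measurable: "cont_bounded_seq V \<Longrightarrow> measurable_seq V"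
  unfolding cont_bounded_seq_def measurable_seq_def by (blast intro: borel_measurable_continuous_onI)

text \<open>The six classes are nested between continuous bounded sequences with integral \<open>1\<close>, which are rich
enough for the lower estimate, and measurable sequences with the asymptotic constraint, to which the
upper estimate applies.\<close>

lemma rate_eq_SUP_test_sequences:
  assumes L: "lim_mode L"
    and R: "R \<in> {measurable_seq, cont_bounded_seq}"
    and C: "C \<in> {exp_integral_le_1 \<mu> a, exp_integral_eq_1 \<mu> a, exp_integral_limsup \<mu> a}"
  shows "rate L x = (SUP V \<in> {V. R V \<and> C V}. Gamma_lim L euclidean V x)"
proof (rule antisym)
  have eq_le: "exp_integral_le_1 \<mu> a V" if "exp_integral_eq_1 \<mu> a V" for V
    using that unfolding exp_integral_le_1_def exp_integral_eq_1_def by simp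
  show "rate L x \<le> (SUP V \<in> {V. R V \<and> C V}. Gamma_lim L euclidean V x)"
  proof (rule rate_le_test_sequences[OF L])
    fix V :: "nat \<Rightarrow> 'a \<Rightarrow> ereal"
    assume "cont_bounded_seq V" "exp_integral_eq_1 \<mu> a V"
    then show "R V \<and> C V"
      using R C cont_bounded_imp_measurable eq_le exp_integral_le_1_imp_limsup by auto
  qed
  have "exp_integral_limsup \<mu> a V" if "C V" for V
    using that C eq_le exp_integral_le_1_imp_limsup by auto
  then show "(SUP V \<in> {V. R V \<and> C V}. Gamma_lim L euclidean V x) \<le> rate L x"
    by (intro SUP_least Gamma_test_le_rate[OF L]) auto
qed

section \<open>Large deviations bounds\<close>

lemma LD_lower_bound_iff:
  "LD_lower_bound \<mu> a J \<longleftrightarrow> (\<forall>U. open U \<longrightarrow> limsup (\<lambda>n. cost n U) \<le> (INF x\<in>U. J x))"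
  unfolding LD_lower_bound_def minus_decay cost_def[symmetric] ereal_Liminf_uminus by simp

lemma LD_weak_upper_bound_iff:
  "LD_weak_upper_bound \<mu> a J \<longleftrightarrow> (\<forall>K. compact K \<longrightarrow> (INF x\<in>K. J x) \<le> liminf (\<lambda>n. cost n K))"
  unfolding LD_weak_upper_bound_def minus_decay cost_def[symmetric] ereal_Limsup_uminus by simp

text \<open>The lower bound is a statement about all pairs of an open set and a point in it, and the same pairs
define the rate.\<close>

lemma LD_lower_bound_iff_rate_le:
  "LD_lower_bound \<mu> a J \<longleftrightarrow> (\<forall>x. rate limsup x \<le> J x)"
  unfolding LD_lower_bound_iff rate_def SUP_le_iff le_INF_iff by blast

text \<open>The number of sets in the cover is absorbed by the loss from \<open>c\<close> to \<open>d\<close>, because \<open>a n\<close> tends to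
infinity.\<close>

lemma finite_union_cost:
  assumes "finite T" "K \<subseteq> (\<Union>x\<in>T. W x)" "\<And>x. x \<in> T \<Longrightarrow> open (W x)"
    and low: "\<And>x. x \<in> T \<Longrightarrow> \<forall>\<^sub>F n in sequentially. ereal c \<le> cost n (W x)" and "d < c"
  shows "\<forall>\<^sub>F n in sequentially. ereal d \<le> cost n K"
proof -
  have "\<forall>\<^sub>F n in sequentially. \<forall>x\<in>T. ereal c \<le> cost n (W x)"
    using assms(1) low by (simp add: eventually_ball_finite)
  moreover have "\<forall>\<^sub>F n in sequentially. ln (real (card T) + 1) / (c - d) \<le> a n"
    using a_lim unfolding filterlim_at_top by blast
  ultimately show ?thesis
  proof eventually_elim
    case (elim n)
    have W: "emeasure (\<mu> n) (W x) \<le> ennreal (exp (- (a n * c)))" if "x \<in> T" for x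
      using elim(1) that by (simp add: le_cost_iff)
    have sets: "W x \<in> sets (\<mu> n)" if "x \<in> T" for x
      using assms(3)[OF that] probs_D(2)[OF probs] by simp
    have "emeasure (\<mu> n) K \<le> emeasure (\<mu> n) (\<Union>x\<in>T. W x)"
      using assms(1,2) sets by (intro emeasure_mono) auto
    also have "\<dots> \<le> (\<Sum>x\<in>T. emeasure (\<mu> n) (W x))"
      using assms(1) sets by (intro emeasure_subadditive_finite) auto
    also have "\<dots> \<le> (\<Sum>x\<in>T. ennreal (exp (- (a n * c))))" by (intro sum_mono W)
    also have "\<dots> = ennreal (real (card T) * exp (- (a n * c)))"
      by (simp add: ennreal_of_nat_eq_real_of_nat ennreal_mult)
    also have "\<dots> \<le> ennreal (exp (- (a n * d)))"
    proof (rule ennreal_leI)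
      have "ln (real (card T) + 1) \<le> a n * (c - d)"
        using elim(2) assms(5) by (simp add: field_simps)
      then have "real (card T) + 1 \<le> exp (a n * (c - d))"
        by (simp add: ln_le_cancel_iff[symmetric] del: ln_le_cancel_iff)
      then have "real (card T) * exp (- (a n * c)) \<le> exp (a n * (c - d)) * exp (- (a n * c))"
        by (intro mult_right_mono) auto
      then show "real (card T) * exp (- (a n * c)) \<le> exp (- (a n * d))"
        by (simp add: exp_add[symmetric] algebra_simps)
    qed
    finally show ?case by (simp add: le_cost_iff)
  qed
qed

lemma rate_liminf_weak_upper_bound: "LD_weak_upper_bound \<mu> a (rate liminf)"
  unfolding LD_weak_upper_bound_iff
proof (intro allI impI, rule dense_le)
  fix K :: "'a set" and y assume K: "compact K" and y: "y < (INF x\<in>K. rate liminf x)"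
  show "y \<le> liminf (\<lambda>n. cost n K)"
  proof (cases "y = - \<infinity>")
    case False
    with y obtain d where d: "y = ereal d" by (cases y) auto
    obtain c' where "ereal d < c'" "c' < (INF x\<in>K. rate liminf x)" using y d dense by blast
    then obtain c where c: "d < c" "ereal c < (INF x\<in>K. rate liminf x)" by (cases c') auto
    have "\<exists>U. open U \<and> x \<in> U \<and> ereal c < liminf (\<lambda>n. cost n U)" if "x \<in> K" for x
    proof -
      have "ereal c < rate liminf x" using c(2) that by (rule less_INF_D)
      then show ?thesis unfolding rate_def less_SUP_iff by auto
    qed
    then obtain W where W: "\<And>x. x \<in> K \<Longrightarrow> open (W x)" "\<And>x. x \<in> K \<Longrightarrow> x \<in> W x"
      "\<And>x. x \<in> K \<Longrightarrow> ereal c < liminf (\<lambda>n. cost n (W x))" by metis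
    obtain T where T: "T \<subseteq> K" "finite T" "K \<subseteq> (\<Union>x\<in>T. W x)"
      using compactE_image[OF K, of K W] W(1,2) by blast
    have "\<forall>\<^sub>F n in sequentially. ereal d \<le> cost n K"
    proof (rule finite_union_cost[OF T(2,3) _ _ c(1)])
      fix x assume "x \<in> T"
      then have x: "x \<in> K" using T(1) by blast
      show "open (W x)" by (rule W(1)[OF x])
      show "\<forall>\<^sub>F n in sequentially. ereal c \<le> cost n (W x)"
        by (rule eventually_mono[OF less_LiminfD[OF W(3)[OF x]]]) simp
    qed
    then show ?thesis unfolding d by (rule Liminf_bounded)
  qed simp
qed

text \<open>A neighbourhood of \<open>x\<close> contains all but finitely many of the sets.\<close>

lemma compact_shrinking_union:
  fixes x :: 'a
  assumes K: "\<And>n. compact (K n)" "\<And>n. K n \<subseteq> ball x (r n)" and r: "r \<longlonglongrightarrow> 0"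
  shows "compact (insert x (\<Union>n. K n))"
  unfolding compact_eq_Heine_Borel
proof (intro allI impI, elim conjE)
  fix \<C> assume C: "\<forall>t\<in>\<C>. open t" "insert x (\<Union>n. K n) \<subseteq> \<Union>\<C>"
  then obtain G where G: "G \<in> \<C>" "x \<in> G" by blast
  then obtain d where d: "d > 0" "ball x d \<subseteq> G" using C(1) openE by blast
  obtain N where N: "\<And>n. n \<ge> N \<Longrightarrow> r n < d"
    using order_tendstoD(2)[OF r d(1)] unfolding eventually_sequentially by blast
  have tail: "K n \<subseteq> G" if "n \<ge> N" for n
    using K(2)[of n] N[OF that] d(2) by (auto simp: subset_iff)
  have "compact (\<Union>n<N. K n)" by (intro compact_UN) (auto simp: K)
  moreover have "(\<Union>n<N. K n) \<subseteq> \<Union>\<C>" using C(2) by blast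
  ultimately obtain \<D> where D: "\<D> \<subseteq> \<C>" "finite \<D>" "(\<Union>n<N. K n) \<subseteq> \<Union>\<D>"
    by (rule compactE) (use C(1) in blast)
  have "insert x (\<Union>n. K n) \<subseteq> \<Union>(insert G \<D>)"
  proof
    fix y assume "y \<in> insert x (\<Union>n. K n)"
    then consider "y = x" | n where "y \<in> K n" by blast
    then show "y \<in> \<Union>(insert G \<D>)"
    proof cases
      case (2 n)
      then show ?thesis using tail[of n] D(3) by (cases "n < N") (blast, force)
    qed (use G in blast)
  qed
  then show "\<exists>\<C>'\<subseteq>\<C>. finite \<C>' \<and> insert x (\<Union>n. K n) \<subseteq> \<Union>\<C>'"
    using D(1,2) G(1) by (intro exI[of _ "insert G \<D>"] conjI) simp_all
qed

text \<open>Inner regularity of finite Borel measures on Polish spaces.\<close>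

lemma compact_inside_with_cost:
  assumes "open B" "cost n B < c"
  obtains K where "compact K" "K \<subseteq> B" "cost n K < c"
proof (cases "cost n B")
  case (real b)
  obtain c' where "cost n B < c'" "c' < c" using assms(2) dense by blast
  then obtain d where d: "b < d" "ereal d < c" using real by (cases c') auto
  interpret prob_space "\<mu> n" using probs_D[OF probs] by simp
  have "\<not> ereal d \<le> cost n B" using real d by simp
  then have "ennreal (exp (- (a n * d))) < emeasure (\<mu> n) B" by (simp add: le_cost_iff not_le)
  also have "emeasure (\<mu> n) B = (SUP K\<in>{K. K \<subseteq> B \<and> compact K}. emeasure (\<mu> n) K)"
    using assms(1) probs_D(2)[OF probs, of n] by (intro inner_regular) auto
  finally obtain K where K: "K \<subseteq> B" "compact K" "ennreal (exp (- (a n * d))) < emeasure (\<mu> n) K"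
    unfolding less_SUP_iff by auto
  then have "\<not> ereal d \<le> cost n K" by (simp add: le_cost_iff not_le)
  then have "cost n K < c" using d(2) by simp
  then show ?thesis using that K by blast
qed (use assms cost_nonneg[of n B] in auto)

text \<open>If the rate at \<open>x\<close> were below \<open>c < J x\<close>, then infinitely many of the shrinking balls would contain
compact sets of cost below \<open>c\<close>. Together with \<open>x\<close> these form a compact set on which, by lower
semicontinuity, \<open>J\<close> stays above a number larger than \<open>c\<close>. This contradicts the upper bound.\<close>

lemma le_rate_liminf:
  assumes J: "lsc J" "LD_weak_upper_bound \<mu> a J"
  shows "J x \<le> rate liminf x"
proof (rule ccontr)
  assume "\<not> ?thesis"
  then have "rate liminf x < J x" by simp
  then obtain c where c: "rate liminf x < c" "c < J x" using dense by blast
  \<comment> \<open>A second level above \<open>c\<close> keeps the final inequality strict after the infimum over the compact set.\<close>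
  obtain c2 where c2: "c < c2" "c2 < J x" using c(2) dense by blast
  have "open (- {y. J y \<le> c2})" using J(1) unfolding lsc_def by (simp add: open_Compl)
  moreover have "x \<in> - {y. J y \<le> c2}" using c2(2) by simp
  ultimately obtain d where d: "d > 0" "ball x d \<subseteq> - {y. J y \<le> c2}" by (rule openE)
  have mode: "lim_mode liminf" by (simp add: lim_mode_def)
  obtain \<kappa> where \<kappa>: "filterlim \<kappa> at_top sequentially"
    "liminf (\<lambda>n. cost n (ball x (1 / real (Suc (\<kappa> n))))) \<le> rate liminf x"
    using shrinking_balls[OF mode] by blast
  define r where "r n = 1 / real (Suc (\<kappa> n))" for n
  have r: "r \<longlonglongrightarrow> 0" unfolding r_def by (rule inverse_Suc_lim[OF \<kappa>(1)])
  obtain N where N: "\<And>n. n \<ge> N \<Longrightarrow> r n < d"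
    using order_tendstoD(2)[OF r d(1)] unfolding eventually_sequentially by blast
  \<comment> \<open>The first \<open>N\<close> balls may leave the region where \<open>J\<close> is large, so nothing is chosen from them.\<close>
  define P where "P n C \<longleftrightarrow> compact C \<and> C \<subseteq> ball x (r n) \<and>
    (N \<le> n \<and> cost n (ball x (r n)) < c \<longrightarrow> cost n C < c) \<and> (n < N \<longrightarrow> C = {})" for n C
  have "\<exists>C. P n C" for n
  proof (cases "N \<le> n \<and> cost n (ball x (r n)) < c")
    case True
    obtain C where "compact C" "C \<subseteq> ball x (r n)" "cost n C < c"
      by (rule compact_inside_with_cost[of "ball x (r n)" n c]) (use True in auto)
    then show ?thesis using True unfolding P_def by (intro exI[of _ C]) auto
  next
    case False
    then show ?thesis unfolding P_def by (intro exI[of _ "{}"]) auto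
  qed
  then obtain K where "\<And>n. P n (K n)" by metis
  then have K: "\<And>n. compact (K n)" "\<And>n. K n \<subseteq> ball x (r n)"
    "\<And>n. N \<le> n \<Longrightarrow> cost n (ball x (r n)) < c \<Longrightarrow> cost n (K n) < c" "\<And>n. n < N \<Longrightarrow> K n = {}"
    unfolding P_def by blast+
  define Q where "Q = insert x (\<Union>n. K n)"
  have Q: "compact Q" unfolding Q_def by (rule compact_shrinking_union[OF K(1,2) r])
  have "c2 \<le> J y" if "y \<in> Q" for y
  proof -
    have "y \<in> ball x d"
    proof (cases "y = x")
      case False
      then obtain n where n: "y \<in> K n" using \<open>y \<in> Q\<close> by (auto simp: Q_def)
      then have "N \<le> n" using K(4)[of n] by (cases "n < N") auto
      then show ?thesis using K(2)[of n] N[of n] n by (auto simp: subset_iff)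
    qed (use d in simp)
    then show ?thesis using d(2) by auto
  qed
  then have "c2 \<le> (INF y\<in>Q. J y)" by (rule INF_greatest)
  also have "\<dots> \<le> liminf (\<lambda>n. cost n Q)" using J(2) Q unfolding LD_weak_upper_bound_iff by blast
  finally have "c < liminf (\<lambda>n. cost n Q)" using c2(1) by simp
  then have "\<forall>\<^sub>F n in sequentially. c < cost n Q" by (rule less_LiminfD)
  then have "\<forall>\<^sub>F n in sequentially. c \<le> cost n (ball x (r n))"
    using eventually_ge_at_top[of N]
  proof eventually_elim
    case (elim n)
    have "cost n Q \<le> cost n (K n)"
      using Q by (intro cost_antimono) (auto simp: Q_def compact_imp_closed)
    then have "\<not> cost n (K n) < c" using elim(1) by simp
    then show ?case using K(3)[of n] elim(2) by (simp add: not_less[symmetric]) blast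
  qed
  then have "c \<le> liminf (\<lambda>n. cost n (ball x (r n)))" by (rule Liminf_bounded)
  with \<kappa>(2) c(1) show False by (simp add: r_def)
qed

lemma rate_liminf_le_limsup: "rate liminf x \<le> rate limsup x"
  unfolding rate_def by (intro SUP_mono' Liminf_le_Limsup) simp

lemma weak_LDP_iff: "weak_LDP \<mu> a \<longleftrightarrow> rate limsup = rate liminf"
proof
  assume "weak_LDP \<mu> a"
  then obtain I where I: "lsc_rate I" "LD_lower_bound \<mu> a I" "LD_weak_upper_bound \<mu> a I"
    unfolding weak_LDP_def by blast
  then have "rate limsup x \<le> rate liminf x" for x
    using le_rate_liminf[of I x] unfolding LD_lower_bound_iff_rate_le lsc_rate_def
    by (meson order_trans)
  then show "rate limsup = rate liminf" using rate_liminf_le_limsup by (intro ext antisym)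
next
  assume eq: "rate limsup = rate liminf"
  have "LD_lower_bound \<mu> a (rate limsup)" unfolding LD_lower_bound_iff_rate_le by simp
  then show "weak_LDP \<mu> a"
    using rate_lsc_rate[of liminf] rate_liminf_weak_upper_bound eq
    unfolding weak_LDP_def by (auto simp: lim_mode_def)
qed

end

theorem proposition4p1:
  fixes \<mu> :: "nat \<Rightarrow> 'a::polish_space measure"
    and a :: "nat \<Rightarrow> real"
    and D :: "'a metric"
  assumes "\<And>n. \<mu> n \<in> borel_probs"
    and "\<And>n. 0 < a n"
    and "filterlim a at_top sequentially"
    and "mtopology_of D = euclidean"
  shows "\<exists>Iup Ilow :: 'a \<Rightarrow> ereal.
    (lsc_rate Iup \<and> LD_lower_bound \<mu> a Iup \<and>
       (\<forall>J. lsc_rate J \<and> LD_lower_bound \<mu> a J \<longrightarrow> (\<forall>x. Iup x \<le> J x))) \<and>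
    (lsc_rate Ilow \<and> LD_weak_upper_bound \<mu> a Ilow \<and>
       (\<forall>J. lsc_rate J \<and> LD_weak_upper_bound \<mu> a J \<longrightarrow> (\<forall>x. J x \<le> Ilow x))) \<and>
    (weak_LDP \<mu> a \<longleftrightarrow> Iup = Ilow) \<and>
    (\<forall>x.
       Iup x = Gamma_limsup narrow_topology (scaled_entropy \<mu> a) (return borel x) \<and>
       ((\<lambda>\<delta>. limsup (\<lambda>n. ereal (- 1 / a n) * eln (emeasure (\<mu> n) (mball_of D x \<delta>))))
          \<longlongrightarrow> Iup x) (at_right 0) \<and>
       (\<forall>R \<in> {measurable_seq, cont_bounded_seq}.
          \<forall>C \<in> {exp_integral_le_1 \<mu> a, exp_integral_eq_1 \<mu> a, exp_integral_limsup \<mu> a}.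
            Iup x = (SUP V \<in> {V. R V \<and> C V}. Gamma_limsup euclidean V x))) \<and>
    (\<forall>x.
       Ilow x = Gamma_liminf narrow_topology (scaled_entropy \<mu> a) (return borel x) \<and>
       ((\<lambda>\<delta>. liminf (\<lambda>n. ereal (- 1 / a n) * eln (emeasure (\<mu> n) (mball_of D x \<delta>))))
          \<longlongrightarrow> Ilow x) (at_right 0) \<and>
       (\<forall>R \<in> {measurable_seq, cont_bounded_seq}.
          \<forall>C \<in> {exp_integral_le_1 \<mu> a, exp_integral_eq_1 \<mu> a, exp_integral_limsup \<mu> a}.
            Ilow x = (SUP V \<in> {V. R V \<and> C V}. Gamma_liminf euclidean V x)))"
proof -
  interpret weighted_sequence \<mu> a using assms(1-3) by unfold_locales
  have mode: "lim_mode limsup" "lim_mode liminf" by (simp_all add: lim_mode_def)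
  show ?thesis
  proof (rule exI[of _ "rate limsup"], rule exI[of _ "rate liminf"],
      intro conjI allI ballI impI)
    show "lsc_rate (rate limsup)" "lsc_rate (rate liminf)"
      by (rule rate_lsc_rate[OF mode(1)], rule rate_lsc_rate[OF mode(2)])
    show "LD_lower_bound \<mu> a (rate limsup)" unfolding LD_lower_bound_iff_rate_le by simp
    show "rate limsup x \<le> J x" if "lsc_rate J \<and> LD_lower_bound \<mu> a J" for J x
      using that unfolding LD_lower_bound_iff_rate_le by simp
    show "LD_weak_upper_bound \<mu> a (rate liminf)" by (rule rate_liminf_weak_upper_bound)
    show "J x \<le> rate liminf x" if "lsc_rate J \<and> LD_weak_upper_bound \<mu> a J" for J x
      using that le_rate_liminf unfolding lsc_rate_def by simp
    show "weak_LDP \<mu> a \<longleftrightarrow> rate limsup = rate liminf" by (rule weak_LDP_iff)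
  next
    fix x
    show "rate limsup x = Gamma_limsup narrow_topology (scaled_entropy \<mu> a) (return borel x)"
      "rate liminf x = Gamma_liminf narrow_topology (scaled_entropy \<mu> a) (return borel x)"
      using rate_eq_Gamma_entropy[OF mode(1)] rate_eq_Gamma_entropy[OF mode(2)]
      by (simp_all add: Gamma_lim_limsup Gamma_lim_liminf)
    show "((\<lambda>\<delta>. limsup (\<lambda>n. ereal (- 1 / a n) * eln (emeasure (\<mu> n) (mball_of D x \<delta>))))
        \<longlongrightarrow> rate limsup x) (at_right 0)"
      "((\<lambda>\<delta>. liminf (\<lambda>n. ereal (- 1 / a n) * eln (emeasure (\<mu> n) (mball_of D x \<delta>))))
        \<longlongrightarrow> rate liminf x) (at_right 0)"
      by (rule rate_limit_balls[OF mode(1) assms(4)], rule rate_limit_balls[OF mode(2) assms(4)])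
  next
    fix x R C
    assume RC: "R \<in> {measurable_seq, cont_bounded_seq :: (nat \<Rightarrow> 'a \<Rightarrow> ereal) \<Rightarrow> bool}"
      "C \<in> {exp_integral_le_1 \<mu> a, exp_integral_eq_1 \<mu> a, exp_integral_limsup \<mu> a}"
    show "rate limsup x = (SUP V \<in> {V. R V \<and> C V}. Gamma_limsup euclidean V x)"
      using rate_eq_SUP_test_sequences[OF mode(1) RC] by (simp add: Gamma_lim_limsup)
    show "rate liminf x = (SUP V \<in> {V. R V \<and> C V}. Gamma_liminf euclidean V x)"
      using rate_eq_SUP_test_sequences[OF mode(2) RC] by (simp add: Gamma_lim_liminf)
  qed
qed

end
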